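(* Let $H=\begin{pmatrix} a & b \\ b & c \end{pmatrix}$ be a trace normed Hamiltonian on $[0,\infty)$ and let $m$ be the corresponding $m$-function. If the function $A(x)=\int_0^x a(t)\,dt$ is rapidly varying at $0$, then $$m(r\mu)=-\frac{1}{\mu f(r)}(1+o(1)),\qquad r\to\infty,$$ uniformly for $\mu$ in any compact subset of $\mathbb{C}$ not intersecting the real line, where $f(r)=rF(r^2)$ and $F$ is the inverse function of $x\mapsto\frac{1}{xA(x)}$.
   Context: Let $J=\begin{pmatrix} 0 & -1 \\ 1 & 0 \end{pmatrix}$. A Hamiltonian on $[0,\infty)$ is a function $H=\begin{pmatrix} a & b \\ b & c \end{pmatrix}$ with real-valued, locally integrable entries on $[0,\infty)$ such that $H(x)\ge 0$ and $H(x)\ne 0$ for almost all $x$, $\int_0^\infty\operatorname{tr}H(x)\,dx=\infty$, and it is not the case that $b=c=0$ almost everywhere. It is trace normed if $a(x)+c(x)=1$ for almost all $x$. Consider $JY'=zHY$ on $[0,\infty)$ and let $U(z,x)$ be its $2\times2$ fundamental matrix solution with $U(z,0)=I_2$. The $m$-function $m:\mathbb{C}\setminus\mathbb{R}\to\mathbb{C}$ is the unique function such that $U(z,\cdot)\begin{pmatrix} 1 \\ m(z) \end{pmatrix}\in L^2([0,\infty);H)$ for every $z\in\mathbb{C}\setminus\mathbb{R}$, where $f\in L^2([0,\infty);H)$ means $\int_0^\infty f^*Hf\,dx<\infty$. A measurable, eventually positive function $f:(x_0,\infty)\to[0,\infty)$ is rapidly varying at $\infty$ if $\lim_{x\to\infty}f(xt)/f(x)=\infty$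 for all $t>1$. A function $f:(0,x_0)\to[0,\infty)$ (positive near $0$) is rapidly varying at $0$ if $x\mapsto1/f(1/x)$ is rapidly varying at $\infty$. *)

theory Defs
  imports "HOL-Analysis.Analysis"
begin

definition hamiltonian :: "(real \<Rightarrow> real^2^2) \<Rightarrow> bool" where
  "hamiltonian H \<longleftrightarrow>
     (\<forall>x\<ge>0. transpose (H x) = H x) \<and>
     (\<forall>R\<ge>0. \<forall>i j. (\<lambda>x. H x $ i $ j) absolutely_integrable_on {0..R}) \<and>
     (AE x\<in>{0..} in lebesgue. (\<forall>v. 0 \<le> v \<bullet> (H x *v v)) \<and> H x \<noteq> 0) \<and>
     (\<integral>\<^sup>+x\<in>{0..}. ennreal (trace (H x)) \<partial>lebesgue) = \<infinity> \<and>
     \<not> (AE x\<in>{0..} in lebesgue. H x $ 1 $ 2 = 0 \<and> H x $ 2 $ 2 = 0)"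

definition trace_normed :: "(real \<Rightarrow> real^2^2) \<Rightarrow> bool" where
  "trace_normed H \<longleftrightarrow> (AE x\<in>{0..} in lebesgue. trace (H x) = 1)"

definition J :: "complex^2^2" where
  "J = vector [vector [0, -1], vector [1, 0]]"

text \<open>
  Solutions of \<open>J Y' = z H Y\<close> are meant in the Caratheodory sense: locally absolutely continuous,
  with the equation holding almost everywhere. As \<open>J\<close> is constant, this amounts to continuity
  together with the integrated equation. The integrand below is absolutely integrable on
  \<open>{0..x}\<close>, being a product of an absolutely integrable and a continuous function.
\<close>

definition fundamental_solution ::
    "(real \<Rightarrow> real^2^2) \<Rightarrow> (complex \<Rightarrow> real \<Rightarrow> complex^2^2) \<Rightarrow> bool" where
  "fundamental_solution H U \<longleftrightarrow>
     (\<forall>z. U z 0 = mat 1 \<and> continuous_on {0..} (U z) \<and>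
        (\<forall>x\<ge>0. ((\<lambda>t. map_matrix (\<lambda>h. z * complex_of_real h) (H t) ** U z t)
                  has_integral J ** (U z x - U z 0)) {0..x}))"

text \<open>The integrand is \<open>f\<^sup>* H f\<close>, which is almost everywhere real and nonnegative.\<close>

definition in_L2 :: "(real \<Rightarrow> real^2^2) \<Rightarrow> (real \<Rightarrow> complex^2) \<Rightarrow> bool" where
  "in_L2 H f \<longleftrightarrow>
     (\<lambda>x. \<Sum>i\<in>UNIV. \<Sum>j\<in>UNIV. cnj (f x $ i) * complex_of_real (H x $ i $ j) * f x $ j)
       absolutely_integrable_on {0..}"

text \<open>
  The values of \<open>m\<close> at real arguments are irrelevant. A Hamiltonian determines both
  its fundamental solution \<open>U\<close> and, off the real line, \<open>m\<close> uniquely.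
\<close>

definition m_function ::
    "(real \<Rightarrow> real^2^2) \<Rightarrow> (complex \<Rightarrow> real \<Rightarrow> complex^2^2) \<Rightarrow> (complex \<Rightarrow> complex) \<Rightarrow> bool" where
  "m_function H U m \<longleftrightarrow> (\<forall>z. z \<notin> \<real> \<longrightarrow> in_L2 H (\<lambda>x. U z x *v vector [1, m z]))"

definition rapidly_varying_at_infinity :: "(real \<Rightarrow> real) \<Rightarrow> bool" where
  "rapidly_varying_at_infinity f \<longleftrightarrow>
     (\<exists>x0. f \<in> borel_measurable (lebesgue_on {x0<..}) \<and> (\<forall>x>x0. 0 \<le> f x)) \<and>
     (\<forall>\<^sub>F x in at_top. 0 < f x) \<and>
     (\<forall>t>1. filterlim (\<lambda>x. f (x * t) / f x) at_top at_top)"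

text \<open>Positivity near \<open>0\<close> is required separately because \<open>1 / 0 = 0\<close>.\<close>

definition rapidly_varying_at_0 :: "(real \<Rightarrow> real) \<Rightarrow> bool" where
  "rapidly_varying_at_0 f \<longleftrightarrow>
     (\<forall>\<^sub>F x in at_right 0. 0 < f x) \<and>
     rapidly_varying_at_infinity (\<lambda>x. 1 / f (1 / x))"

end

theory Submission
  imports Defs
begin

text \<open>
  Let \<open>X = F (r\<^sup>2)\<close>, so that \<open>r\<^sup>2 X A(X) = 1\<close>, and rescale \<open>x = t X\<close>, \<open>M = r X m(r \<mu>)\<close>. Rapid variation says
  that the rescaled mass of \<open>a\<close> on \<open>[0, t]\<close> tends to \<open>0\<close> for \<open>t < 1\<close> and to \<open>\<infinity>\<close> for \<open>t > 1\<close>, so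
  the limiting system has \<open>H = diag(0, 1)\<close> on \<open>[0, 1]\<close> and then an infinite mass of \<open>diag(1, 0)\<close>, which
  forces the first component \<open>1 + \<mu> M\<close> of the solution at \<open>t = 1\<close> to vanish.

  This is made quantitative with the energy bound \<open>\<integral> f\<^sup>* H f \<le> Im m / Im z\<close> alone. By the
  Cauchy--Schwarz inequality it controls the increments of both components of \<open>f = U (1, m)\<close>: before \<open>t = 1\<close>
  the solution is close to \<open>(1 + \<mu> t M, M)\<close>, and near \<open>t = 1\<close> the first component barely moves because
  \<open>c \<le> 1\<close>. Hence if \<open>1 + \<mu> M\<close> were not small, the large mass of \<open>a\<close> just after \<open>t = 1\<close> would violate the
  energy bound.
\<close>

section \<open>Integrals and the product rule\<close>

text \<open>There is no a priori bound on \<open>M\<close>, and the energy bound is itself of size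
  \<open>|M|\<close>: in rescaled units it is \<open>e\<^sup>2 = |M| / \<beta>\<close> with
  \<open>\<beta>\<close> the least \<open>|Im \<mu>|\<close>. All errors are therefore estimated by
  a small multiple of \<open>1 + |M|\<close>, and the loop closes because
  \<open>\<beta> |M| \<le> 1 + |1 + \<mu> M|\<close>, so that a small multiple of
  \<open>|1 + \<mu> M|\<close> can be absorbed on the left. The mass ratio \<open>\<kappa>\<close>
  just beyond \<open>t = 1\<close> is uncontrollably large and enters both sides, since it also lets
  the second component vary by a multiple of \<open>sqrt \<kappa>\<close>. That variation is squared
  and multiplied by the length \<open>2 \<eta>\<close> of the window, so dividing by
  \<open>\<kappa>\<close> leaves \<open>1 / \<kappa> + \<eta>\<close>. Hence \<open>\<eta>\<close>
  is fixed before \<open>r\<close> tends to infinity. The definition of \<open>m\<close> gives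
  finite energy only, not the constant \<open>Im m / Im z\<close>. Trace norming excludes two
  independent solutions of finite energy, and compactness then supplies a solution with the exact
  bound, which must be the given one.\<close>

lemma absolutely_integrable_times_continuous:
  fixes f g :: "real \<Rightarrow> 'a::{euclidean_space, real_normed_algebra}"
  assumes "f absolutely_integrable_on {x..y}" "continuous_on {x..y} g"
  shows "(\<lambda>t. f t * g t) absolutely_integrable_on {x..y}"
proof -
  have "bilinear (\<lambda>u v :: 'a. v * u)"
    unfolding bilinear_def by (auto intro!: linearI simp: algebra_simps)
  moreover have "g \<in> borel_measurable (lebesgue_on {x..y})"
    using assms(2) by (simp add: continuous_imp_measurable_on_sets_lebesgue)
  moreover have "bounded (g ` {x..y})"
    using assms(2) by (simp add: compact_continuous_image compact_imp_bounded)
  ultimately show ?thesis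
    using absolutely_integrable_bounded_measurable_product[of "\<lambda>u v. v * u" g "{x..y}" f] assms(1)
    by simp
qed

lemma absolutely_integrable_complex_of_real:
  assumes "f absolutely_integrable_on S"
  shows "(\<lambda>t. complex_of_real (f t)) absolutely_integrable_on S"
  using absolutely_integrable_linear[OF assms bounded_linear_of_real] by (simp add: o_def)

lemma absolutely_integrable_cnj:
  assumes "f absolutely_integrable_on S"
  shows "(\<lambda>t. cnj (f t)) absolutely_integrable_on S"
  using absolutely_integrable_linear[OF assms bounded_linear_cnj] by (simp add: o_def)

lemma absolutely_integrable_imp_integrable:
  fixes f :: "real \<Rightarrow> 'a::euclidean_space"
  shows "f absolutely_integrable_on S \<Longrightarrow> f integrable_on S"
  by (simp add: absolutely_integrable_on_def)

text \<open>The right side is least at \<open>s = sqrt (\<gamma> / \<alpha>)\<close>, with value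
  \<open>2 * sqrt (\<alpha> * \<gamma>)\<close>. This point is missing when \<open>\<alpha>\<close>
  or \<open>\<gamma>\<close> vanishes, so both are raised by \<open>e > 0\<close>, which then tends
  to \<open>0\<close>.\<close>

lemma le_sqrt_mult_of_weighted_bound:
  fixes p \<alpha> \<gamma> :: real
  assumes "\<alpha> \<ge> 0" "\<gamma> \<ge> 0" and bound: "\<And>s. s > 0 \<Longrightarrow> 2 * p \<le> s * \<alpha> + \<gamma> / s"
  shows "p \<le> sqrt (\<alpha> * \<gamma>)"
proof -
  have main: "p \<le> sqrt ((\<alpha> + e) * (\<gamma> + e))" if "e > 0" for e
  proof -
    define P Q s where "P = sqrt (\<alpha> + e)" and "Q = sqrt (\<gamma> + e)" and "s = Q / P"
    have pos: "P > 0" "Q > 0" "s > 0" and sq: "\<alpha> + e = P\<^sup>2" "\<gamma> + e = Q\<^sup>2"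
      using assms that by (auto simp: P_def Q_def s_def)
    have "s * \<alpha> + \<gamma> / s \<le> s * (\<alpha> + e) + (\<gamma> + e) / s"
      using pos that by (intro add_mono mult_left_mono divide_right_mono) auto
    also have "\<dots> = 2 * (P * Q)"
      using pos unfolding sq s_def by (simp add: field_simps power2_eq_square)
    also have "P * Q = sqrt ((\<alpha> + e) * (\<gamma> + e))"
      by (simp add: P_def Q_def real_sqrt_mult)
    finally show ?thesis
      using bound[OF \<open>s > 0\<close>] by simp
  qed
  have "((\<lambda>e. sqrt ((\<alpha> + e) * (\<gamma> + e))) \<longlongrightarrow> sqrt ((\<alpha> + 0) * (\<gamma> + 0))) (at_right 0)"
    by (intro tendsto_intros)
  moreover have "\<forall>\<^sub>F e in at_right 0. p \<le> sqrt ((\<alpha> + e) * (\<gamma> + e))"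
    using main by (auto simp: eventually_at_right_less intro: eventually_mono[OF eventually_at_right_less[of 0]])
  ultimately show ?thesis
    using tendsto_lowerbound[of "\<lambda>e. sqrt ((\<alpha> + e) * (\<gamma> + e))" "sqrt (\<alpha> * \<gamma>)" "at_right 0" p]
    by simp
qed

text \<open>Integrating \<open>2 |f| \<le> s g + h / s\<close> and optimising \<open>s\<close>
  afterwards works directly with gauge integrals: no square root is ever integrated.\<close>

lemma has_integral_Cauchy_Schwarz:
  fixes f :: "real \<Rightarrow> complex" and g h :: "real \<Rightarrow> real"
  assumes f: "(f has_integral I) S" and g: "g integrable_on S" and h: "h integrable_on S"
    and nonneg: "\<And>t. t \<in> S \<Longrightarrow> 0 \<le> g t" "\<And>t. t \<in> S \<Longrightarrow> 0 \<le> h t"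
    and bound: "\<And>t. t \<in> S \<Longrightarrow> norm (f t) \<le> sqrt (g t) * sqrt (h t)"
  shows "norm I \<le> sqrt (integral S g * integral S h)"
proof (rule le_sqrt_mult_of_weighted_bound)
  show "0 \<le> integral S g" "0 \<le> integral S h"
    using nonneg by (auto intro!: integral_nonneg g h)
  fix s :: real assume s: "s > 0"
  have "2 * norm (f t) \<le> s * g t + h t / s" if "t \<in> S" for t
  proof -
    have "0 \<le> (sqrt s * sqrt (g t) - sqrt (h t) / sqrt s)\<^sup>2" by simp
    also have "\<dots> = s * g t + h t / s - 2 * (sqrt (g t) * sqrt (h t))"
      using s nonneg[OF that] by (simp add: power2_diff power_mult_distrib power_divide)
    finally show ?thesis using bound[OF that] by linarith
  qed
  then have "norm (f t) \<le> (s * g t + h t / s) / 2" if "t \<in> S" for t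
    using that by fastforce
  moreover have "(\<lambda>t. (s * g t + h t / s) / 2) integrable_on S"
    using g h by (auto intro!: integrable_add integrable_on_divide integrable_on_mult_right)
  ultimately have "norm (integral S f) \<le> integral S (\<lambda>t. (s * g t + h t / s) / 2)"
    using f by (intro integral_norm_bound_integral) (auto simp: has_integral_integrable)
  also have "\<dots> = (s * integral S g + integral S h / s) / 2"
    using g h by (simp add: integral_add integrable_on_divide integrable_on_mult_right)
  finally show "2 * norm I \<le> s * integral S g + integral S h / s"
    using f by (simp add: integral_unique)
qed

text \<open>Difference quotients are of the order of the step, so the derivative vanishes at every
  point of the interval, not only almost everywhere.\<close>

lemma quadratic_modulus_imp_constant:
  fixes D :: "real \<Rightarrow> 'a::real_normed_vector"
  assumes "\<And>x y. 0 \<le> x \<Longrightarrow> x \<le> y \<Longrightarrow> y \<le> R \<Longrightarrow> norm (D y - D x) \<le> C * (y - x)\<^sup>2" and "0 \<le> R"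
  shows "D R = D 0"
proof -
  have "(D has_derivative (\<lambda>h. 0)) (at x within {0..R})" if x: "x \<in> {0..R}" for x
    unfolding has_derivative_within_alt
  proof (intro conjI allI impI)
    fix e :: real assume e: "e > 0"
    have "norm (D y - D x - 0) \<le> e * norm (y - x)"
      if y: "y \<in> {0..R}" "norm (y - x) < e / (\<bar>C\<bar> + 1)" for y
    proof -
      have "norm (D y - D x) \<le> C * (y - x)\<^sup>2"
        using assms(1)[of x y] assms(1)[of y x] x y
        by (cases "x \<le> y") (auto simp: norm_minus_commute power2_commute)
      also have "\<dots> \<le> (\<bar>C\<bar> + 1) * (y - x)\<^sup>2"
        by (intro mult_right_mono) auto
      also have "\<dots> = ((\<bar>C\<bar> + 1) * norm (y - x)) * norm (y - x)"
        by (simp add: power2_eq_square)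
      also have "\<dots> \<le> e * norm (y - x)"
        using y by (intro mult_right_mono) (auto simp: field_simps)
      finally show ?thesis by simp
    qed
    then show "\<exists>d>0. \<forall>y\<in>{0..R}. norm (y - x) < d \<longrightarrow> norm (D y - D x - 0) \<le> e * norm (y - x)"
      using e by (intro exI[of _ "e / (\<bar>C\<bar> + 1)"]) auto
  qed simp
  then obtain c where "\<forall>x\<in>{0..R}. D x = c"
    using has_derivative_zero_constant[of "{0..R}" D] by auto
  then show ?thesis using \<open>0 \<le> R\<close> by simp
qed

text \<open>The derivatives \<open>p\<close>, \<open>q\<close> exist only almost everywhere, but they are bounded, so both sides of
  the product rule agree up to an error quadratic in the length of the interval.\<close>

lemma has_integral_product_rule:
  fixes p q u v :: "real \<Rightarrow> complex"
  assumes p: "p absolutely_integrable_on {0..R}" and q: "q absolutely_integrable_on {0..R}"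
    and u: "continuous_on {0..R} u" and v: "continuous_on {0..R} v"
    and du: "\<And>x y. 0 \<le> x \<Longrightarrow> x \<le> y \<Longrightarrow> y \<le> R \<Longrightarrow> (p has_integral (u y - u x)) {x..y}"
    and dv: "\<And>x y. 0 \<le> x \<Longrightarrow> x \<le> y \<Longrightarrow> y \<le> R \<Longrightarrow> (q has_integral (v y - v x)) {x..y}"
    and Bp: "\<And>t. t \<in> {0..R} \<Longrightarrow> norm (p t) \<le> B" and Bq: "\<And>t. t \<in> {0..R} \<Longrightarrow> norm (q t) \<le> B"
    and R: "0 \<le> R"
  shows "((\<lambda>t. p t * v t + u t * q t) has_integral (u R * v R - u 0 * v 0)) {0..R}"
proof -
  define w where "w = (\<lambda>t. p t * v t + u t * q t)"
  have "w absolutely_integrable_on {0..R}"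
    unfolding w_def using absolutely_integrable_times_continuous[OF p v]
      absolutely_integrable_times_continuous[OF q u] by (simp add: mult.commute)
  then have w: "w integrable_on {x..y}" if "0 \<le> x" "y \<le> R" for x y
    using integrable_on_subinterval[OF absolutely_integrable_imp_integrable, where f = w and S = "{0..R}" and a = x and b = y] that
    by auto
  have B: "0 \<le> B" using R order_trans[OF norm_ge_zero Bp[of 0]] by simp
  have lu: "norm (u y - u x) \<le> B * (y - x)" if "0 \<le> x" "x \<le> y" "y \<le> R" for x y
    using has_integral_bound_real[OF B _ du[OF that], of "{}"] Bp that by auto
  have lv: "norm (v y - v x) \<le> B * (y - x)" if "0 \<le> x" "x \<le> y" "y \<le> R" for x y
    using has_integral_bound_real[OF B _ dv[OF that], of "{}"] Bq that by auto
  define D where "D = (\<lambda>x. u x * v x - integral {0..x} w)"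
  have "D R = D 0"
  proof (rule quadratic_modulus_imp_constant[OF _ R])
    fix x y assume xy: "0 \<le> x" "x \<le> y" "y \<le> R"
    \<comment> \<open>With \<open>v\<close> frozen at the right end and \<open>u\<close> at the left
      end, the integrand integrates exactly to \<open>u y * v y - u x * v x\<close>. The error of
      freezing is a bounded derivative times a Lipschitz increment.\<close>
    have "((\<lambda>t. p t * v y + u x * q t) has_integral ((u y - u x) * v y + u x * (v y - v x))) {x..y}"
      using xy by (intro has_integral_add has_integral_mult_left has_integral_mult_right du dv)
    moreover have "(w has_integral integral {x..y} w) {x..y}"
      using w xy by blast
    ultimately have "((\<lambda>t. p t * v y + u x * q t - w t) has_integral
        ((u y - u x) * v y + u x * (v y - v x) - integral {x..y} w)) {x..y}"
      by (rule has_integral_diff)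
    moreover have "(u y - u x) * v y + u x * (v y - v x) - integral {x..y} w = D y - D x"
      using Henstock_Kurzweil_Integration.integral_combine[of 0 x y w] w[of 0 y] xy by (simp add: D_def algebra_simps)
    ultimately have I: "((\<lambda>t. p t * v y + u x * q t - w t) has_integral (D y - D x)) {x..y}"
      by simp
    have "norm (p t * v y + u x * q t - w t) \<le> 2 * B\<^sup>2 * (y - x)" if t: "t \<in> {x..y}" for t
    proof -
      have "p t * v y + u x * q t - w t = p t * (v y - v t) - (u t - u x) * q t"
        by (simp add: w_def algebra_simps)
      also have "norm \<dots> \<le> norm (p t) * norm (v y - v t) + norm (u t - u x) * norm (q t)"
        by (metis norm_mult norm_triangle_ineq4)
      also have "\<dots> \<le> B * (B * (y - t)) + (B * (t - x)) * B"
        using t xy B by (intro add_mono mult_mono lu lv Bp Bq) auto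
      also have "\<dots> = B\<^sup>2 * (y - x)"
        by (simp add: power2_eq_square algebra_simps)
      also have "\<dots> \<le> 2 * B\<^sup>2 * (y - x)" using xy by simp
      finally show ?thesis .
    qed
    then have "norm (D y - D x) \<le> 2 * B\<^sup>2 * (y - x) * (y - x)"
      using has_integral_bound_real[OF _ _ I, of "2 * B\<^sup>2 * (y - x)" "{}"] xy by auto
    then show "norm (D y - D x) \<le> 2 * B\<^sup>2 * (y - x)\<^sup>2"
      by (simp add: power2_eq_square mult.assoc)
  qed
  then have "integral {0..R} w = u R * v R - u 0 * v 0"
    by (simp add: D_def algebra_simps)
  then show ?thesis
    using w[of 0 R] R unfolding w_def by (metis integrable_integral order_refl)
qed

section \<open>Canonical systems\<close>

text \<open>This is the integrand of the energy: the Hermitian form of the real symmetric matrix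
  with rows \<open>(A, B)\<close> and \<open>(B, C)\<close> at the vector
  \<open>(u, v)\<close>.\<close>

definition qform :: "real \<Rightarrow> real \<Rightarrow> real \<Rightarrow> complex \<Rightarrow> complex \<Rightarrow> real" where
  "qform A B C u v = A * (cmod u)\<^sup>2 + 2 * B * Re (cnj u * v) + C * (cmod v)\<^sup>2"

text \<open>A Cholesky factorization with upper triangular factor \<open>(p, q; 0, r)\<close>, which
  turns the form into a sum of two squares. If \<open>A = 0\<close>, nonnegativity of the
  determinant forces \<open>B = 0\<close>.\<close>

lemma psd_factorization:
  fixes A B C :: real
  assumes "A \<ge> 0" "C \<ge> 0" "B\<^sup>2 \<le> A * C"
  obtains p q r where "A = p\<^sup>2" "B = p * q" "C = q\<^sup>2 + r\<^sup>2"
proof (cases "A = 0")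
  case True
  then have "A = 0\<^sup>2" "B = 0 * 0" "C = 0\<^sup>2 + (sqrt C)\<^sup>2"
    using assms by auto
  then show ?thesis by (rule that)
next
  case False
  then have "A > 0" using assms by simp
  then have "B\<^sup>2 / A \<le> C" using assms by (simp add: field_simps)
  then have "A = (sqrt A)\<^sup>2" "B = sqrt A * (B / sqrt A)"
      "C = (B / sqrt A)\<^sup>2 + (sqrt (C - B\<^sup>2 / A))\<^sup>2"
    using \<open>A > 0\<close> by (auto simp: power_divide)
  then show ?thesis by (rule that)
qed

lemma qform_factorized:
  "qform (p\<^sup>2) (p * q) (q\<^sup>2 + r\<^sup>2) u v = (cmod (p * u + q * v))\<^sup>2 + (cmod (r * v))\<^sup>2"
  unfolding qform_def cmod_power2 by (simp add: power2_eq_square algebra_simps)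

lemma qform_scale: "qform A B C (k * u) (k * v) = (cmod k)\<^sup>2 * qform A B C u v"
proof -
  have "cnj (k * u) * (k * v) = of_real ((cmod k)\<^sup>2) * (cnj u * v)"
    by (simp add: complex_norm_square[symmetric] mult_ac)
  then have "Re (cnj (k * u) * (k * v)) = (cmod k)\<^sup>2 * Re (cnj u * v)"
    by (metis Re_complex_of_real times_complex.sel(1) Im_complex_of_real mult_zero_left diff_zero)
  then show ?thesis
    unfolding qform_def norm_mult power_mult_distrib by (simp add: algebra_simps)
qed

section \<open>Inequalities for the form of a nonnegative 2x2 matrix\<close>

context
  fixes A B C :: real
  assumes psd: "A \<ge> 0" "C \<ge> 0" "B\<^sup>2 \<le> A * C"
begin

lemma qform_nonneg: "0 \<le> qform A B C u v"
proof -
  obtain p q r where *: "A = p\<^sup>2" "B = p * q" "C = q\<^sup>2 + r\<^sup>2" using psd_factorization[OF psd] .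
  show ?thesis unfolding * qform_factorized by simp
qed

text \<open>The Cauchy-Schwarz inequality for the form against the first unit vector, whose own form
  value is \<open>A\<close>. The next lemma does the same for the second unit vector.\<close>

lemma qform_row1_le: "cmod (A * u + B * v) \<le> sqrt A * sqrt (qform A B C u v)" for u v :: complex
proof -
  obtain p q r where *: "A = p\<^sup>2" "B = p * q" "C = q\<^sup>2 + r\<^sup>2" using psd_factorization[OF psd] .
  have "A * u + B * v = p * (p * u + q * v)"
    unfolding * by (simp add: power2_eq_square algebra_simps)
  then have "cmod (A * u + B * v) = \<bar>p\<bar> * cmod (p * u + q * v)"
    by (simp add: norm_mult)
  also have "cmod (p * u + q * v) \<le> sqrt (qform A B C u v)"
    unfolding * qform_factorized by (rule real_le_rsqrt) simp
  finally show ?thesis by (simp add: * mult_left_mono)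
qed

lemma qform_row2_le: "cmod (B * u + C * v) \<le> sqrt C * sqrt (qform A B C u v)" for u v :: complex
proof -
  obtain p q r where *: "A = p\<^sup>2" "B = p * q" "C = q\<^sup>2 + r\<^sup>2" using psd_factorization[OF psd] .
  have "B * u + C * v = q * (p * u + q * v) + r * (r * v)"
    unfolding * by (simp add: power2_eq_square algebra_simps)
  also have "cmod \<dots> \<le> \<bar>q\<bar> * cmod (p * u + q * v) + \<bar>r\<bar> * cmod (r * v)"
    by (rule norm_triangle_le) (simp add: norm_mult)
  also have "\<dots> \<le> sqrt (q\<^sup>2 + r\<^sup>2) * sqrt ((cmod (p * u + q * v))\<^sup>2 + (cmod (r * v))\<^sup>2)"
    unfolding real_sqrt_mult[symmetric]
  proof (rule real_le_rsqrt)
    \<comment> \<open>Lagrange's identity, which yields the Cauchy-Schwarz inequality in the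
      plane.\<close>
    have "(\<bar>q\<bar> * x + \<bar>r\<bar> * y)\<^sup>2 + (\<bar>q\<bar> * y - \<bar>r\<bar> * x)\<^sup>2 = (q\<^sup>2 + r\<^sup>2) * (x\<^sup>2 + y\<^sup>2)" for x y
      by (simp add: power2_eq_square algebra_simps)
    then show "(\<bar>q\<bar> * cmod (p * u + q * v) + \<bar>r\<bar> * cmod (r * v))\<^sup>2
        \<le> (q\<^sup>2 + r\<^sup>2) * ((cmod (p * u + q * v))\<^sup>2 + (cmod (r * v))\<^sup>2)"
      by (metis le_add_same_cancel1 zero_le_power2)
  qed
  finally show ?thesis by (simp add: * qform_factorized)
qed

text \<open>The left side is bilinear, without conjugation, because multiplying by a Wronskian
  produces such products. Only moduli matter after factorization, so the Hermitian form still
  dominates.\<close>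

lemma qform_bilinear_le:
  "cmod (A * (u * u') + B * (u * v' + v * u') + C * (v * v')) \<le> qform A B C u v + qform A B C u' v'"
  for u v u' v' :: complex
proof -
  obtain p q r where *: "A = p\<^sup>2" "B = p * q" "C = q\<^sup>2 + r\<^sup>2" using psd_factorization[OF psd] .
  have "A * (u * u') + B * (u * v' + v * u') + C * (v * v')
      = (p * u + q * v) * (p * u' + q * v') + (r * v) * (r * v')"
    unfolding * by (simp add: power2_eq_square algebra_simps)
  also have "cmod \<dots> \<le> cmod (p * u + q * v) * cmod (p * u' + q * v') + cmod (r * v) * cmod (r * v')"
    by (metis norm_mult norm_triangle_ineq)
  also have "\<dots> \<le> qform A B C u v + qform A B C u' v'"
  proof -
    have "x * y \<le> x\<^sup>2 + y\<^sup>2" for x y :: real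
      using zero_le_power2[of "x - y"] zero_le_power2[of "x + y"] by (simp add: power2_eq_square algebra_simps)
    then show ?thesis unfolding * qform_factorized by (smt (verit))
  qed
  finally show ?thesis .
qed

lemma qform_add_le:
  "qform A B C (u + u') (v + v') \<le> 2 * qform A B C u v + 2 * qform A B C u' v'"
proof -
  have "qform A B C (u + u') (v + v') + qform A B C (u - u') (v - v')
      = 2 * qform A B C u v + 2 * qform A B C u' v'"
    unfolding qform_def cmod_power2 by (simp add: power2_eq_square algebra_simps)
  then show ?thesis using qform_nonneg[of "u - u'" "v - v'"] by simp
qed

lemma qform_lin_comb_le:
  "qform A B C (k * u + k' * u') (k * v + k' * v')
     \<le> 2 * (cmod k)\<^sup>2 * qform A B C u v + 2 * (cmod k')\<^sup>2 * qform A B C u' v'"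
  using qform_add_le[of "k * u" "k' * u'" "k * v" "k' * v'"] 
  by (simp only: qform_scale mult.assoc)

text \<open>Isolates the \<open>a\<close>-part of the energy: \<open>(u, 0)\<close> is the sum of
  \<open>(u, v)\<close> and \<open>(0, -v)\<close>, so the off-diagonal entry disappears at the
  price of a factor \<open>2\<close>.\<close>

lemma qform_diag1_le: "A * (cmod u)\<^sup>2 \<le> 2 * qform A B C u v + 2 * C * (cmod v)\<^sup>2"
proof -
  have "qform A B C (u + 0) (v + - v) = A * (cmod u)\<^sup>2" "qform A B C 0 (- v) = C * (cmod v)\<^sup>2"
    by (simp_all add: qform_def)
  then show ?thesis using qform_add_le[of u 0 v "- v"] by (simp only: mult.assoc)
qed

end

section \<open>The scalar form of the system, its energy identity and its Wronskian\<close>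

lemma has_integral_difference:
  fixes f :: "real \<Rightarrow> 'a::euclidean_space"
  assumes "(f has_integral I) {a..x}" "(f has_integral K) {a..y}" "a \<le> x" "x \<le> y"
  shows "(f has_integral (K - I)) {x..y}"
proof -
  have "f integrable_on {x..y}"
    using assms by (intro integrable_on_subinterval[OF has_integral_integrable[OF assms(2)]]) auto
  moreover have "I + integral {x..y} f = K"
    using Henstock_Kurzweil_Integration.integral_combine[of a x y f] assms by (auto simp: integral_unique)
  ultimately show ?thesis by (metis add_diff_cancel_left' integrable_integral)
qed

text \<open>The conditions are imposed at every real \<open>t\<close>, although a Hamiltonian
  satisfies them only almost everywhere on the half-line. A change on a null set achieves this later
  and spares all pointwise estimates an exceptional set.\<close>

locale canonical_system =
  fixes a b c :: "real \<Rightarrow> real"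
  assumes abs_integrable: "\<And>R. a absolutely_integrable_on {0..R}"
      "\<And>R. b absolutely_integrable_on {0..R}" "\<And>R. c absolutely_integrable_on {0..R}"
    and a_nonneg: "\<And>t. 0 \<le> a t" and c_nonneg: "\<And>t. 0 \<le> c t"
    and det_nonneg: "\<And>t. (b t)\<^sup>2 \<le> a t * c t" and trace_1: "\<And>t. a t + c t = 1"
begin

definition edens :: "(real \<Rightarrow> complex) \<Rightarrow> (real \<Rightarrow> complex) \<Rightarrow> real \<Rightarrow> real" where
  "edens f1 f2 t = qform (a t) (b t) (c t) (f1 t) (f2 t)"

text \<open>The integrated rows of \<open>J Y' = z H Y\<close>: since
  \<open>J Y' = (- f2', f1')\<close>, the second row of \<open>H\<close> drives \<open>f1\<close>
  and the first row, with a minus sign, drives \<open>f2\<close>.\<close>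

definition sol :: "complex \<Rightarrow> (real \<Rightarrow> complex) \<Rightarrow> (real \<Rightarrow> complex) \<Rightarrow> bool" where
  "sol z f1 f2 \<longleftrightarrow> continuous_on {0..} f1 \<and> continuous_on {0..} f2 \<and>
     (\<forall>x\<ge>0. ((\<lambda>t. z * (complex_of_real (b t) * f1 t + complex_of_real (c t) * f2 t)) has_integral (f1 x - f1 0)) {0..x}) \<and>
     (\<forall>x\<ge>0. ((\<lambda>t. - z * (complex_of_real (a t) * f1 t + complex_of_real (b t) * f2 t)) has_integral (f2 x - f2 0)) {0..x})"

lemmas psd = a_nonneg c_nonneg det_nonneg

lemma edens_nonneg: "0 \<le> edens f1 f2 t"
  unfolding edens_def by (rule qform_nonneg[OF psd])

lemma coeff_le_1: "a t \<le> 1" "c t \<le> 1" "\<bar>b t\<bar> \<le> 1"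
proof -
  show "a t \<le> 1" "c t \<le> 1" using trace_1[of t] a_nonneg[of t] c_nonneg[of t] by auto
  then have "a t * c t \<le> 1 * 1"
    using a_nonneg[of t] c_nonneg[of t] by (intro mult_mono) auto
  then show "\<bar>b t\<bar> \<le> 1"
    using det_nonneg[of t] abs_square_le_1[of "b t"] by linarith
qed

lemma abs_integrable_on:
  assumes "0 \<le> x"
  shows "a absolutely_integrable_on {x..y}" "b absolutely_integrable_on {x..y}"
    "c absolutely_integrable_on {x..y}"
  using absolutely_integrable_on_subinterval[OF abs_integrable(1), of x y y]
    absolutely_integrable_on_subinterval[OF abs_integrable(2), of x y y]
    absolutely_integrable_on_subinterval[OF abs_integrable(3), of x y y] assms by auto

lemma row_abs_integrable:
  assumes "continuous_on {0..} f1" "continuous_on {0..} f2" "0 \<le> x"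
  shows "(\<lambda>t. complex_of_real (a t) * f1 t + complex_of_real (b t) * f2 t) absolutely_integrable_on {x..y}"
    and "(\<lambda>t. complex_of_real (b t) * f1 t + complex_of_real (c t) * f2 t) absolutely_integrable_on {x..y}"
proof -
  have "continuous_on {x..y} f1" "continuous_on {x..y} f2"
    using assms by (auto intro: continuous_on_subset)
  then show "(\<lambda>t. complex_of_real (a t) * f1 t + complex_of_real (b t) * f2 t) absolutely_integrable_on {x..y}"
    "(\<lambda>t. complex_of_real (b t) * f1 t + complex_of_real (c t) * f2 t) absolutely_integrable_on {x..y}"
    using assms(3) by (auto intro!: set_integral_add absolutely_integrable_times_continuous
        absolutely_integrable_complex_of_real abs_integrable_on)
qed

lemma edens_integrable:
  assumes "continuous_on {0..} f1" "continuous_on {0..} f2" "0 \<le> x"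
  shows "edens f1 f2 integrable_on {x..y}"
proof -
  have c: "continuous_on {x..y} f1" "continuous_on {x..y} f2"
    using assms by (auto intro: continuous_on_subset)
  have "(\<lambda>t. a t * (cmod (f1 t))\<^sup>2 + b t * (2 * Re (cnj (f1 t) * f2 t)) + c t * (cmod (f2 t))\<^sup>2)
      absolutely_integrable_on {x..y}"
    using assms(3) c by (intro set_integral_add absolutely_integrable_times_continuous
        abs_integrable_on continuous_intros) auto
  then show ?thesis
    unfolding edens_def[abs_def] qform_def
    by (intro absolutely_integrable_imp_integrable) (simp add: mult_ac)
qed

lemma
  assumes "sol z f1 f2"
  shows sol_continuous: "continuous_on {0..} f1" "continuous_on {0..} f2"
    and sol_increment: "0 \<le> x \<Longrightarrow> x \<le> y \<Longrightarrow>
          ((\<lambda>t. z * (complex_of_real (b t) * f1 t + complex_of_real (c t) * f2 t)) has_integral (f1 y - f1 x)) {x..y}"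
        "0 \<le> x \<Longrightarrow> x \<le> y \<Longrightarrow>
          ((\<lambda>t. - z * (complex_of_real (a t) * f1 t + complex_of_real (b t) * f2 t)) has_integral (f2 y - f2 x)) {x..y}"
proof -
  show "continuous_on {0..} f1" "continuous_on {0..} f2"
    using assms by (auto simp: sol_def)
  assume xy: "0 \<le> x" "x \<le> y"
  show "((\<lambda>t. z * (complex_of_real (b t) * f1 t + complex_of_real (c t) * f2 t)) has_integral (f1 y - f1 x)) {x..y}"
    using has_integral_difference[of "\<lambda>t. z * (complex_of_real (b t) * f1 t + complex_of_real (c t) * f2 t)" "f1 x - f1 0" 0 x "f1 y - f1 0" y]
      assms xy by (auto simp: sol_def)
  show "((\<lambda>t. - z * (complex_of_real (a t) * f1 t + complex_of_real (b t) * f2 t)) has_integral (f2 y - f2 x)) {x..y}"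
    using has_integral_difference[of "\<lambda>t. - z * (complex_of_real (a t) * f1 t + complex_of_real (b t) * f2 t)" "f2 x - f2 0" 0 x "f2 y - f2 0" y]
      assms xy by (auto simp: sol_def)
qed

text \<open>Supplies the boundedness required by the product rule. Trace norming makes all entries
  at most \<open>1\<close> in modulus, and continuous solutions are bounded on compact
  intervals.\<close>

lemma sol_derivative_bounded:
  assumes "sol z f1 f2"
  obtains K where "\<And>t. t \<in> {0..R} \<Longrightarrow> cmod (z * (complex_of_real (b t) * f1 t + complex_of_real (c t) * f2 t)) \<le> K"
    "\<And>t. t \<in> {0..R} \<Longrightarrow> cmod (- z * (complex_of_real (a t) * f1 t + complex_of_real (b t) * f2 t)) \<le> K"
proof -
  have "bounded ((\<lambda>t. cmod (f1 t) + cmod (f2 t)) ` {0..R})"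
    using sol_continuous[OF assms]
    by (intro compact_imp_bounded compact_continuous_image continuous_intros)
       (auto intro: continuous_on_subset)
  then obtain B where B: "\<And>t. t \<in> {0..R} \<Longrightarrow> cmod (f1 t) + cmod (f2 t) \<le> B"
    unfolding bounded_iff by fastforce
  have lin: "cmod (of_real s * u + of_real s' * v) \<le> cmod u + cmod v"
    if "\<bar>s\<bar> \<le> 1" "\<bar>s'\<bar> \<le> 1" for s s' u v
  proof -
    have "cmod (of_real s * u + of_real s' * v) \<le> \<bar>s\<bar> * cmod u + \<bar>s'\<bar> * cmod v"
      by (rule norm_triangle_le) (simp add: norm_mult)
    also have "\<dots> \<le> 1 * cmod u + 1 * cmod v"
      using that by (intro add_mono mult_right_mono) auto
    finally show ?thesis by simp
  qed
  show ?thesis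
    by (rule that[of "cmod z * B"])
       (auto simp: norm_mult coeff_le_1 a_nonneg c_nonneg intro!: mult_left_mono order_trans[OF lin B])
qed

text \<open>Green's identity: the derivative of \<open>Im (cnj f1 * f2)\<close> is
  \<open>- Im z\<close> times the energy density. Thus the sign of
  \<open>Im (cnj (f1 R) * f2 R) / Im z\<close> decides whether the energy up to \<open>R\<close>
  stays below its value at \<open>0\<close>.\<close>

lemma energy_identity:
  assumes "sol z f1 f2" "0 \<le> R"
  shows "Im (cnj (f1 R) * f2 R) = Im (cnj (f1 0) * f2 0) - Im z * integral {0..R} (edens f1 f2)"
proof -
  note s = assms(1) note cont = sol_continuous[OF s]
  have c: "continuous_on {0..R} f1" "continuous_on {0..R} f2"
    using cont by (auto intro: continuous_on_subset)
  obtain K where K: "\<And>t. t \<in> {0..R} \<Longrightarrow> cmod (z * (complex_of_real (b t) * f1 t + complex_of_real (c t) * f2 t)) \<le> K"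
    "\<And>t. t \<in> {0..R} \<Longrightarrow> cmod (- z * (complex_of_real (a t) * f1 t + complex_of_real (b t) * f2 t)) \<le> K"
    using sol_derivative_bounded[OF s] by blast
  have "((\<lambda>t. cnj (z * (complex_of_real (b t) * f1 t + complex_of_real (c t) * f2 t)) * f2 t + cnj (f1 t) * (- z * (complex_of_real (a t) * f1 t + complex_of_real (b t) * f2 t)))
      has_integral (cnj (f1 R) * f2 R - cnj (f1 0) * f2 0)) {0..R}"
  proof (rule has_integral_product_rule)
    show "(\<lambda>t. cnj (z * (complex_of_real (b t) * f1 t + complex_of_real (c t) * f2 t))) absolutely_integrable_on {0..R}"
      "(\<lambda>t. - z * (complex_of_real (a t) * f1 t + complex_of_real (b t) * f2 t)) absolutely_integrable_on {0..R}"
      using row_abs_integrable[OF cont]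
      by (intro absolutely_integrable_cnj set_integrable_mult_right; blast)+
    show "((\<lambda>t. cnj (z * (complex_of_real (b t) * f1 t + complex_of_real (c t) * f2 t)))
        has_integral cnj (f1 y) - cnj (f1 x)) {x..y}" if "0 \<le> x" "x \<le> y" for x y
      using has_integral_linear[OF sol_increment(1)[OF s that] bounded_linear_cnj] by (simp add: o_def)
    show "cmod (cnj (z * (complex_of_real (b t) * f1 t + complex_of_real (c t) * f2 t))) \<le> K"
      if "t \<in> {0..R}" for t
      using K(1)[OF that] by (metis complex_mod_cnj)
    show "continuous_on {0..R} (\<lambda>t. cnj (f1 t))"
      by (intro continuous_intros c)
  qed (use c(2) sol_increment(2)[OF s] K(2) assms(2) in simp_all)
  then have "((\<lambda>t. Im (cnj (z * (complex_of_real (b t) * f1 t + complex_of_real (c t) * f2 t)) * f2 t + cnj (f1 t) * (- z * (complex_of_real (a t) * f1 t + complex_of_real (b t) * f2 t))))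
      has_integral Im (cnj (f1 R) * f2 R - cnj (f1 0) * f2 0)) {0..R}"
    by (rule has_integral_Im)
  moreover have "Im (cnj (z * (complex_of_real (b t) * f1 t + complex_of_real (c t) * f2 t)) * f2 t + cnj (f1 t) * (- z * (complex_of_real (a t) * f1 t + complex_of_real (b t) * f2 t)))
      = - Im z * edens f1 f2 t" for t
    unfolding edens_def qform_def cmod_power2 by (simp add: power2_eq_square algebra_simps)
  ultimately have "((\<lambda>t. - Im z * edens f1 f2 t) has_integral Im (cnj (f1 R) * f2 R - cnj (f1 0) * f2 0)) {0..R}"
    by simp
  moreover have "((\<lambda>t. - Im z * edens f1 f2 t) has_integral - Im z * integral {0..R} (edens f1 f2)) {0..R}"
    using edens_integrable[OF cont] by (intro has_integral_mult_right integrable_integral) auto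
  ultimately have "Im (cnj (f1 R) * f2 R - cnj (f1 0) * f2 0) = - Im z * integral {0..R} (edens f1 f2)"
    by (rule has_integral_unique)
  then show ?thesis by (simp only: minus_complex.sel)
qed

text \<open>The derivative of \<open>f1 * g2\<close> is
  \<open>z * (c * f2 * g2 - a * f1 * g1)\<close>, which is symmetric in \<open>f\<close> and
  \<open>g\<close>; hence it equals that of \<open>g1 * f2\<close>.\<close>

lemma wronskian_constant:
  assumes f: "sol z f1 f2" and g: "sol z g1 g2" and R: "0 \<le> R"
  shows "f1 R * g2 R - f2 R * g1 R = f1 0 * g2 0 - f2 0 * g1 0"
proof -
  have pr: "((\<lambda>t. z * (complex_of_real (b t) * f1 t + complex_of_real (c t) * f2 t) * g2 t + f1 t * (- z * (complex_of_real (a t) * g1 t + complex_of_real (b t) * g2 t)))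
      has_integral (f1 R * g2 R - f1 0 * g2 0)) {0..R}"
    if f: "sol z f1 f2" and g: "sol z g1 g2" for f1 f2 g1 g2
  proof -
    note cf = sol_continuous[OF f] and cg = sol_continuous[OF g]
    have c: "continuous_on {0..R} f1" "continuous_on {0..R} g2"
      using cf cg by (auto intro: continuous_on_subset)
    obtain K where K: "\<And>t. t \<in> {0..R} \<Longrightarrow> cmod (z * (complex_of_real (b t) * f1 t + complex_of_real (c t) * f2 t)) \<le> K"
      using sol_derivative_bounded[OF f] by blast
    obtain K' where K': "\<And>t. t \<in> {0..R} \<Longrightarrow> cmod (- z * (complex_of_real (a t) * g1 t + complex_of_real (b t) * g2 t)) \<le> K'"
      using sol_derivative_bounded[OF g] by blast
    show ?thesis
    proof (rule has_integral_product_rule[where B = "max K K'"])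
      show "(\<lambda>t. z * (complex_of_real (b t) * f1 t + complex_of_real (c t) * f2 t)) absolutely_integrable_on {0..R}"
        "(\<lambda>t. - z * (complex_of_real (a t) * g1 t + complex_of_real (b t) * g2 t)) absolutely_integrable_on {0..R}"
        using row_abs_integrable[OF cf] row_abs_integrable[OF cg]
        by (intro set_integrable_mult_right; blast)+
    qed (use c sol_increment(2)[OF g] sol_increment(1)[OF f] K K' R in \<open>auto simp: le_max_iff_disj\<close>)
  qed
  have "((\<lambda>t. 0) has_integral (f1 R * g2 R - f1 0 * g2 0) - (g1 R * f2 R - g1 0 * f2 0)) {0..R}"
    using has_integral_diff[OF pr[OF f g] pr[OF g f]] by (simp add: algebra_simps)
  then have "(f1 R * g2 R - f1 0 * g2 0) - (g1 R * f2 R - g1 0 * f2 0) = 0"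
    using has_integral_unique has_integral_0 by blast
  then show ?thesis by (simp add: algebra_simps)
qed

lemma sol_lin_comb:
  assumes "sol z f1 f2" "sol z g1 g2"
  shows "sol z (\<lambda>x. k * f1 x + k' * g1 x) (\<lambda>x. k * f2 x + k' * g2 x)"
  unfolding sol_def
proof (intro conjI allI impI)
  fix x :: real assume x: "0 \<le> x"
  show "((\<lambda>t. z * (complex_of_real (b t) * (k * f1 t + k' * g1 t) + complex_of_real (c t) * (k * f2 t + k' * g2 t))) has_integral
      k * f1 x + k' * g1 x - (k * f1 0 + k' * g1 0)) {0..x}"
    using has_integral_add[OF has_integral_mult_right[OF sol_increment(1)[OF assms(1) order_refl x], of k]
        has_integral_mult_right[OF sol_increment(1)[OF assms(2) order_refl x], of k']]
    by (simp add: algebra_simps)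
  show "((\<lambda>t. - z * (complex_of_real (a t) * (k * f1 t + k' * g1 t) + complex_of_real (b t) * (k * f2 t + k' * g2 t))) has_integral
      k * f2 x + k' * g2 x - (k * f2 0 + k' * g2 0)) {0..x}"
    using has_integral_add[OF has_integral_mult_right[OF sol_increment(2)[OF assms(1) order_refl x], of k]
        has_integral_mult_right[OF sol_increment(2)[OF assms(2) order_refl x], of k']]
    by (simp add: algebra_simps)
next
  show "continuous_on {0..} (\<lambda>x. k * f1 x + k' * g1 x)" "continuous_on {0..} (\<lambda>x. k * f2 x + k' * g2 x)"
    using sol_continuous[OF assms(1)] sol_continuous[OF assms(2)]
    by (auto intro: continuous_on_add continuous_on_mult_left)
qed

end

section \<open>The limit point case and the energy bound\<close>

context
  fixes A B C :: real and u v u' v' :: complex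
  assumes psd: "A \<ge> 0" "C \<ge> 0" "B\<^sup>2 \<le> A * C" and W: "u * v' - v * u' = 1"
begin

text \<open>With \<open>W = 1\<close> the unit vectors are \<open>(0, 1) = u (u', v') - u' (u, v)\<close> and
  \<open>(1, 0) = v' (u, v) - v (u', v')\<close>, which turns linear expressions in \<open>H\<close> into quadratic ones.\<close>

lemma qform_rows_le:
  shows "cmod (B * u + C * v) \<le> 2 * (cmod u + cmod u') * (qform A B C u v + qform A B C u' v')"
    and "cmod (B * u' + C * v') \<le> 2 * (cmod u + cmod u') * (qform A B C u v + qform A B C u' v')"
    and "cmod (A * u + B * v) \<le> 2 * (cmod v + cmod v') * (qform A B C u v + qform A B C u' v')"
    and "cmod (A * u' + B * v') \<le> 2 * (cmod v + cmod v') * (qform A B C u v + qform A B C u' v')"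
proof -
  define h :: "complex \<Rightarrow> complex \<Rightarrow> complex \<Rightarrow> complex \<Rightarrow> complex"
    where "h x y x' y' = A * (x * x') + B * (x * y' + y * x') + C * (y * y')" for x y x' y' :: complex
  define Q where "Q = qform A B C u v + qform A B C u' v'"
  have nn: "0 \<le> qform A B C u v" "0 \<le> qform A B C u' v'"
    by (rule qform_nonneg[OF psd])+
  have h: "cmod (h u v u v) \<le> 2 * Q" "cmod (h u v u' v') \<le> 2 * Q" "cmod (h u' v' u' v') \<le> 2 * Q"
    using qform_bilinear_le[OF psd, of u u v v] qform_bilinear_le[OF psd, of u u' v' v]
      qform_bilinear_le[OF psd, of u' u' v' v'] nn unfolding h_def Q_def by auto
  have comb: "cmod (s * x + s' * y) \<le> 2 * (cmod s' + cmod s) * Q"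
    if "cmod x \<le> 2 * Q" "cmod y \<le> 2 * Q" for s s' x y :: complex
  proof -
    have "cmod (s * x + s' * y) \<le> cmod s * cmod x + cmod s' * cmod y"
      by (metis norm_mult norm_triangle_ineq)
    also have "\<dots> \<le> cmod s * (2 * Q) + cmod s' * (2 * Q)"
      using that by (intro add_mono mult_left_mono) auto
    finally show ?thesis by (simp add: algebra_simps)
  qed
  have "B * u + C * v = (B * u + C * v) * (u * v' - v * u')" by (simp add: W)
  also have "\<dots> = (- u') * h u v u v + u * h u v u' v'"
    by (simp add: h_def algebra_simps)
  finally show "cmod (B * u + C * v) \<le> 2 * (cmod u + cmod u') * (qform A B C u v + qform A B C u' v')"
    using comb[OF h(1) h(2), of "- u'" u] by (simp add: Q_def)
  have "B * u' + C * v' = (B * u' + C * v') * (u * v' - v * u')" by (simp add: W)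
  also have "\<dots> = (- u') * h u v u' v' + u * h u' v' u' v'"
    by (simp add: h_def algebra_simps)
  finally show "cmod (B * u' + C * v') \<le> 2 * (cmod u + cmod u') * (qform A B C u v + qform A B C u' v')"
    using comb[OF h(2) h(3), of "- u'" u] by (simp add: Q_def)
  have "A * u + B * v = (A * u + B * v) * (u * v' - v * u')" by (simp add: W)
  also have "\<dots> = v' * h u v u v + (- v) * h u v u' v'"
    by (simp add: h_def algebra_simps)
  finally show "cmod (A * u + B * v) \<le> 2 * (cmod v + cmod v') * (qform A B C u v + qform A B C u' v')"
    using comb[OF h(1) h(2), of v' "- v"] by (simp add: Q_def)
  have "A * u' + B * v' = (A * u' + B * v') * (u * v' - v * u')" by (simp add: W)
  also have "\<dots> = v' * h u v u' v' + (- v) * h u' v' u' v'"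
    by (simp add: h_def algebra_simps)
  finally show "cmod (A * u' + B * v') \<le> 2 * (cmod v + cmod v') * (qform A B C u v + qform A B C u' v')"
    using comb[OF h(2) h(3), of v' "- v"] by (simp add: Q_def)
qed

lemma qform_diagonal_le:
  shows "C \<le> 2 * (cmod u + cmod u')\<^sup>2 * (qform A B C u v + qform A B C u' v')"
    and "A \<le> 2 * (cmod v + cmod v')\<^sup>2 * (qform A B C u v + qform A B C u' v')"
proof -
  have nn: "0 \<le> qform A B C u v" "0 \<le> qform A B C u' v'"
    by (rule qform_nonneg[OF psd])+
  have bound: "2 * x\<^sup>2 * qform A B C u v + 2 * y\<^sup>2 * qform A B C u' v'
      \<le> 2 * (y + x)\<^sup>2 * (qform A B C u v + qform A B C u' v')" if "0 \<le> x" "0 \<le> y" for x y :: real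
  proof -
    have "x\<^sup>2 \<le> (y + x)\<^sup>2" "y\<^sup>2 \<le> (y + x)\<^sup>2" using that by (auto intro: power_mono)
    then have "2 * x\<^sup>2 * qform A B C u v + 2 * y\<^sup>2 * qform A B C u' v'
        \<le> 2 * (y + x)\<^sup>2 * qform A B C u v + 2 * (y + x)\<^sup>2 * qform A B C u' v'"
      using nn by (intro add_mono mult_right_mono mult_left_mono) auto
    then show ?thesis by (simp add: algebra_simps)
  qed
  have e: "- u' * u + u * u' = 0" "- u' * v + u * v' = 1" "v' * u + - v * u' = 1" "v' * v + - v * v' = 0"
    using W by (auto simp: algebra_simps)
  have "C = qform A B C (- u' * u + u * u') (- u' * v + u * v')"
    unfolding e by (simp add: qform_def)
  also have "\<dots> \<le> 2 * (cmod u')\<^sup>2 * qform A B C u v + 2 * (cmod u)\<^sup>2 * qform A B C u' v'"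
    using qform_lin_comb_le[OF psd, of "- u'" u u u' v v'] by simp
  finally show "C \<le> 2 * (cmod u + cmod u')\<^sup>2 * (qform A B C u v + qform A B C u' v')"
    using bound[OF norm_ge_zero[of u'] norm_ge_zero[of u]] by linarith
  have "A = qform A B C (v' * u + - v * u') (v' * v + - v * v')"
    unfolding e by (simp add: qform_def)
  also have "\<dots> \<le> 2 * (cmod v')\<^sup>2 * qform A B C u v + 2 * (cmod v)\<^sup>2 * qform A B C u' v'"
    using qform_lin_comb_le[OF psd, of v' u "- v" u' v v'] by simp
  finally show "A \<le> 2 * (cmod v + cmod v')\<^sup>2 * (qform A B C u v + qform A B C u' v')"
    using bound[OF norm_ge_zero[of v'] norm_ge_zero[of v]] by linarith
qed

end

text \<open>The integrals over \<open>[0, x]\<close> have a finite supremum. Starting where they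
  come within \<open>\<epsilon>\<close> of it leaves at most \<open>\<epsilon>\<close> for any later
  interval.\<close>

lemma integral_tail_small:
  fixes P :: "real \<Rightarrow> real"
  assumes P: "\<And>x y. 0 \<le> x \<Longrightarrow> P integrable_on {x..y}"
    and bounded: "\<And>x. 0 \<le> x \<Longrightarrow> integral {0..x} P \<le> K" and "\<epsilon> > 0"
  obtains x1 where "0 \<le> x1" "\<And>y. x1 \<le> y \<Longrightarrow> integral {x1..y} P \<le> \<epsilon>"
proof -
  define S where "S = (SUP x\<in>{0..}. integral {0..x} P)"
  have bdd: "bdd_above ((\<lambda>x. integral {0..x} P) ` {0..})"
    using bounded by (auto intro!: bdd_aboveI[of _ K])
  have "S - \<epsilon> < S" using assms by simp
  then obtain x1 where x1: "x1 \<in> {0..}" "S - \<epsilon> < integral {0..x1} P"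
    unfolding S_def using less_cSUP_iff[OF _ bdd] by fastforce
  have "integral {x1..y} P \<le> \<epsilon>" if "x1 \<le> y" for y
  proof -
    have "integral {0..y} P \<le> S"
      unfolding S_def using x1 that by (intro cSUP_upper bdd) auto
    then show ?thesis
      using Henstock_Kurzweil_Integration.integral_combine[of 0 x1 y P] P[of 0 y] x1 that by simp
  qed
  then show ?thesis using x1 by (intro that[of x1]) auto
qed

text \<open>A substitute for Gronwall's inequality. Beyond \<open>x1\<close> the integral of
  \<open>P\<close> is so small that up to a maximum point each function changes by at most a quarter
  of the maximum \<open>S\<close>; so \<open>S\<close> is at most the value at \<open>x1\<close>
  plus \<open>S / 2\<close>.\<close>

lemma bounded_of_integral_inequality:
  fixes u v :: "real \<Rightarrow> complex" and P :: "real \<Rightarrow> real"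
  assumes cont: "continuous_on {0..} u" "continuous_on {0..} v"
    and P: "\<And>x y. 0 \<le> x \<Longrightarrow> P integrable_on {x..y}" and nn: "\<And>t. 0 \<le> P t"
    and bounded: "\<And>x. 0 \<le> x \<Longrightarrow> integral {0..x} P \<le> K" and k: "0 \<le> k"
    and incr: "\<And>x y S. 0 \<le> x \<Longrightarrow> x \<le> y \<Longrightarrow> (\<And>t. t \<in> {x..y} \<Longrightarrow> cmod (u t) + cmod (v t) \<le> S) \<Longrightarrow>
          cmod (u y - u x) \<le> k * S * integral {x..y} P \<and> cmod (v y - v x) \<le> k * S * integral {x..y} P"
  obtains x1 N where "0 \<le> x1" "\<And>t. x1 \<le> t \<Longrightarrow> cmod (u t) + cmod (v t) \<le> N"
proof -
  \<comment> \<open>The tail \<open>1 / (4 * k + 1)\<close> gives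
    \<open>k / (4 * k + 1) \<le> 1 / 4\<close> and is still defined for
    \<open>k = 0\<close>.\<close>
  obtain x1 where x1: "0 \<le> x1" "\<And>y. x1 \<le> y \<Longrightarrow> integral {x1..y} P \<le> 1 / (4 * k + 1)"
    using integral_tail_small[OF P bounded, of "1 / (4 * k + 1)"] k by (auto simp: add_nonneg_pos)
  have "cmod (u t) + cmod (v t) \<le> 2 * (cmod (u x1) + cmod (v x1))" if t: "x1 \<le> t" for t
  proof -
    have "continuous_on {x1..t} (\<lambda>s. cmod (u s) + cmod (v s))"
      using x1 by (intro continuous_intros continuous_on_subset[OF cont(1)] continuous_on_subset[OF cont(2)]) auto
    then obtain y where y: "y \<in> {x1..t}" "\<And>s. s \<in> {x1..t} \<Longrightarrow> cmod (u s) + cmod (v s) \<le> cmod (u y) + cmod (v y)"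
      using continuous_attains_sup[of "{x1..t}" "\<lambda>s. cmod (u s) + cmod (v s)"] t by auto
    define S where "S = cmod (u y) + cmod (v y)"
    have I: "0 \<le> integral {x1..y} P" "integral {x1..y} P \<le> 1 / (4 * k + 1)"
      using x1 y nn by (auto intro!: integral_nonneg P)
    have "S \<ge> 0" by (simp add: S_def)
    have "k * S * integral {x1..y} P \<le> k * S * (1 / (4 * k + 1))"
      using I k \<open>S \<ge> 0\<close> by (intro mult_left_mono) auto
    also have "\<dots> \<le> S / 4"
      using k \<open>S \<ge> 0\<close> by (simp add: field_simps)
    finally have "cmod (u y - u x1) \<le> S / 4" "cmod (v y - v x1) \<le> S / 4"
      using incr[of x1 y S] x1 y unfolding S_def by force+
    then have "cmod (u y) \<le> cmod (u x1) + S / 4" "cmod (v y) \<le> cmod (v x1) + S / 4"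
      using norm_triangle_sub[of "u y" "u x1"] norm_triangle_sub[of "v y" "v x1"] by auto
    then have "S \<le> 2 * (cmod (u x1) + cmod (v x1))"
      unfolding S_def by argo
    then show ?thesis using y(2)[of t] t unfolding S_def by force
  qed
  then show ?thesis using that x1 by blast
qed

context canonical_system
begin

text \<open>With Wronskian \<open>1\<close>, the derivatives of both solutions are bounded by their
  size times the total energy density \<open>P\<close>, so both are eventually bounded. Then
  \<open>1 = a + c\<close> is at most a constant times \<open>P\<close>, which is impossible on a
  half-line if \<open>P\<close> has bounded integrals.\<close>

lemma limit_point:
  assumes f: "sol z f1 f2" and g: "sol z g1 g2" and W: "f1 0 * g2 0 - f2 0 * g1 0 = 1"
    and Kf: "\<And>x. 0 \<le> x \<Longrightarrow> integral {0..x} (edens f1 f2) \<le> K"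
    and Kg: "\<And>x. 0 \<le> x \<Longrightarrow> integral {0..x} (edens g1 g2) \<le> K'"
  shows False
proof -
  note cont = sol_continuous[OF f] sol_continuous[OF g]
  define P where "P t = edens f1 f2 t + edens g1 g2 t" for t
  have P: "P integrable_on {x..y}" if "0 \<le> x" for x y
    unfolding P_def[abs_def] using that cont by (intro integrable_add edens_integrable)
  have nn: "0 \<le> P t" for t by (simp add: P_def edens_nonneg)
  have bounded: "integral {0..x} P \<le> K + K'" if "0 \<le> x" for x
    using Kf[OF that] Kg[OF that] edens_integrable cont unfolding P_def[abs_def]
    by (subst integral_add) auto
  have Wt: "f1 t * g2 t - f2 t * g1 t = 1" if "0 \<le> t" for t
    using wronskian_constant[OF f g that] W by simp
  have rows: "cmod (b t * f1 t + c t * f2 t) \<le> 2 * (cmod (f1 t) + cmod (g1 t)) * P t"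
    "cmod (b t * g1 t + c t * g2 t) \<le> 2 * (cmod (f1 t) + cmod (g1 t)) * P t"
    "cmod (a t * f1 t + b t * f2 t) \<le> 2 * (cmod (f2 t) + cmod (g2 t)) * P t"
    "cmod (a t * g1 t + b t * g2 t) \<le> 2 * (cmod (f2 t) + cmod (g2 t)) * P t" if "0 \<le> t" for t
    unfolding P_def edens_def by (rule qform_rows_le[OF psd Wt[OF that]])+
  have diag: "c t \<le> 2 * (cmod (f1 t) + cmod (g1 t))\<^sup>2 * P t"
    "a t \<le> 2 * (cmod (f2 t) + cmod (g2 t))\<^sup>2 * P t" if "0 \<le> t" for t
    unfolding P_def edens_def by (rule qform_diagonal_le[OF psd Wt[OF that]])+
  have incr: "cmod I \<le> (2 * cmod z) * S * integral {x..y} P"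
    if "0 \<le> x" and I: "((\<lambda>t. k * w t) has_integral I) {x..y}" and "cmod k = cmod z"
      and "\<And>t. 0 \<le> t \<Longrightarrow> cmod (w t) \<le> 2 * N t * P t" "\<And>t. t \<in> {x..y} \<Longrightarrow> N t \<le> S"
    for I x y S k and w :: "real \<Rightarrow> complex" and N
  proof -
    have "cmod (integral {x..y} (\<lambda>t. k * w t)) \<le> integral {x..y} (\<lambda>t. (2 * cmod z) * S * P t)"
    proof (rule integral_norm_bound_integral)
      show "cmod (k * w t) \<le> (2 * cmod z) * S * P t" if t: "t \<in> {x..y}" for t
      proof -
        have "cmod (w t) \<le> 2 * N t * P t" using that t \<open>0 \<le> x\<close> \<open>\<And>t. 0 \<le> t \<Longrightarrow> cmod (w t) \<le> 2 * N t * P t\<close> by auto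
        also have "\<dots> \<le> 2 * S * P t"
          using \<open>\<And>t. t \<in> {x..y} \<Longrightarrow> N t \<le> S\<close>[OF t] nn[of t] by (intro mult_right_mono) auto
        finally show ?thesis
          using mult_left_mono[of "cmod (w t)" "2 * S * P t" "cmod z"] \<open>cmod k = cmod z\<close>
          by (simp add: norm_mult mult_ac)
      qed
    qed (use that P in \<open>auto intro: integrable_on_mult_right\<close>)
    then show ?thesis unfolding integral_unique[OF I] by simp
  qed
  obtain x1 N1 where 1: "0 \<le> x1" "\<And>t. x1 \<le> t \<Longrightarrow> cmod (f1 t) + cmod (g1 t) \<le> N1"
  proof (rule bounded_of_integral_inequality[OF cont(1,3) P nn bounded])
    fix x y S :: real assume "0 \<le> x" "x \<le> y" "\<And>t. t \<in> {x..y} \<Longrightarrow> cmod (f1 t) + cmod (g1 t) \<le> S"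
    then show "cmod (f1 y - f1 x) \<le> (2 * cmod z) * S * integral {x..y} P \<and>
        cmod (g1 y - g1 x) \<le> (2 * cmod z) * S * integral {x..y} P"
      using incr[OF _ sol_increment(1)[OF f] refl rows(1)] incr[OF _ sol_increment(1)[OF g] refl rows(2)]
      by auto
  qed auto
  obtain x2 N2 where 2: "0 \<le> x2" "\<And>t. x2 \<le> t \<Longrightarrow> cmod (f2 t) + cmod (g2 t) \<le> N2"
  proof (rule bounded_of_integral_inequality[OF cont(2,4) P nn bounded])
    fix x y S :: real assume *: "0 \<le> x" "x \<le> y" "\<And>t. t \<in> {x..y} \<Longrightarrow> cmod (f2 t) + cmod (g2 t) \<le> S"
    then show "cmod (f2 y - f2 x) \<le> (2 * cmod z) * S * integral {x..y} P \<and>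
        cmod (g2 y - g2 x) \<le> (2 * cmod z) * S * integral {x..y} P"
      using incr[OF _ sol_increment(2)[OF f] norm_minus_cancel rows(3)]
        incr[OF _ sol_increment(2)[OF g] norm_minus_cancel rows(4)] by auto
  qed auto
  define x0 where "x0 = max x1 x2"
  define M where "M = 2 * N1\<^sup>2 + 2 * N2\<^sup>2"
  have one_le: "1 \<le> M * P t" if t: "x0 \<le> t" for t
  proof -
    have t0: "0 \<le> t" "x1 \<le> t" "x2 \<le> t" using t 1(1) by (auto simp: x0_def)
    have "c t \<le> 2 * N1\<^sup>2 * P t"
      using diag(1)[OF t0(1)] 1(2)[OF t0(2)] nn[of t]
      by (elim order_trans) (intro mult_right_mono mult_left_mono power_mono; simp)
    moreover have "a t \<le> 2 * N2\<^sup>2 * P t"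
      using diag(2)[OF t0(1)] 2(2)[OF t0(3)] nn[of t]
      by (elim order_trans) (intro mult_right_mono mult_left_mono power_mono; simp)
    ultimately show ?thesis using trace_1[of t] by (simp add: M_def algebra_simps)
  qed
  \<comment> \<open>The interval from \<open>x0\<close> to \<open>y\<close> is made longer than
    \<open>M * (K + K')\<close>.\<close>
  define y where "y = x0 + \<bar>M * (K + K')\<bar> + 1"
  have x0: "0 \<le> x0" "x0 \<le> y" using 1(1) by (auto simp: x0_def y_def)
  have "integral {x0..y} (\<lambda>t. 1 :: real) \<le> integral {x0..y} (\<lambda>t. M * P t)"
    using x0 one_le P by (intro integral_le integrable_on_mult_right) auto
  also have "\<dots> = M * integral {x0..y} P" by simp
  also have "\<dots> \<le> M * integral {0..y} P"
    using x0 nn by (intro mult_left_mono integral_subset_le P) (auto simp: M_def)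
  also have "\<dots> \<le> M * (K + K')"
    using x0 by (intro mult_left_mono bounded) (auto simp: M_def)
  finally show False using x0 by (simp add: y_def)
qed

lemma edens_scale: "edens (\<lambda>x. k * f1 x) (\<lambda>x. k * f2 x) = (\<lambda>t. (cmod k)\<^sup>2 * edens f1 f2 t)"
  by (simp add: edens_def qform_scale fun_eq_iff)

lemma sol_scale: "sol z f1 f2 \<Longrightarrow> sol z (\<lambda>x. k * f1 x) (\<lambda>x. k * f2 x)"
  using sol_lin_comb[of z f1 f2 f1 f2 k 0] by simp

text \<open>A Weyl disk argument: the nested compact sets of initial values whose solutions satisfy the
  energy bound up to \<open>n\<close> have a common point, which by the limit point property is
  proportional to \<open>(1, m)\<close>.\<close>

lemma weyl_energy_bound:
  assumes \<phi>: "sol z \<phi>1 \<phi>2" "\<phi>1 0 = 1" "\<phi>2 0 = 0" and \<theta>: "sol z \<theta>1 \<theta>2" "\<theta>1 0 = 0" "\<theta>2 0 = 1"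
    and z: "Im z \<noteq> 0"
    and K: "\<And>x. 0 \<le> x \<Longrightarrow>
      integral {0..x} (edens (\<lambda>x. \<phi>1 x + m * \<theta>1 x) (\<lambda>x. \<phi>2 x + m * \<theta>2 x)) \<le> K"
    and x: "0 \<le> x"
  shows "integral {0..x} (edens (\<lambda>x. \<phi>1 x + m * \<theta>1 x) (\<lambda>x. \<phi>2 x + m * \<theta>2 x)) \<le> Im m / Im z"
proof -
  define F1 where "F1 p x = fst p * \<phi>1 x + snd p * \<theta>1 x" for p and x :: real
  define F2 where "F2 p x = fst p * \<phi>2 x + snd p * \<theta>2 x" for p and x :: real
  \<comment> \<open>By Green's identity \<open>Q p x\<close> is \<open>Q p 0\<close> minus the
    energy on \<open>[0, x]\<close>. So \<open>0 \<le> Q p x\<close> says exactly that this energy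
    is at most \<open>Q p 0\<close>.\<close>
  define Q where "Q p x = Im (cnj (F1 p x) * F2 p x) / Im z" for p x
  have sol: "sol z (F1 p) (F2 p)" for p
    using sol_lin_comb[OF \<phi>(1) \<theta>(1)] unfolding F1_def[abs_def] F2_def[abs_def] .
  have Q: "Q p x = Q p 0 - integral {0..x} (edens (F1 p) (F2 p))" if "0 \<le> x" for p x
    unfolding Q_def energy_identity[OF sol that] using z by (simp add: field_simps)
  have mono: "integral {0..x} (edens (F1 p) (F2 p)) \<le> integral {0..y} (edens (F1 p) (F2 p))"
    if "0 \<le> x" "x \<le> y" for p x y
    using that edens_nonneg sol_continuous[OF sol] by (intro integral_subset_le edens_integrable) auto
  \<comment> \<open>Initial values are taken on the unit sphere of pairs: this makes the sets
    compact and keeps the zero solution out of the intersection.\<close>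
  define S where "S n = {p \<in> sphere 0 1. 0 \<le> Q p (real n)}" for n
  have "\<Inter> (range S) \<noteq> {}"
  proof (rule compact_nest)
    fix n :: nat
    have "closed {p. 0 \<le> Q p (real n)}"
      unfolding Q_def F1_def F2_def by (intro closed_Collect_le continuous_intros) (simp_all add: z)
    then have "compact (sphere 0 1 \<inter> {p. 0 \<le> Q p (real n)})"
      by (intro compact_Int_closed compact_sphere)
    also have "sphere 0 1 \<inter> {p. 0 \<le> Q p (real n)} = S n" by (auto simp: S_def)
    finally show "compact (S n)" .
    \<comment> \<open>The inverse of the fundamental matrix at \<open>n\<close>, of determinant
      \<open>1\<close>, applied to \<open>(1, \<i> * Im z)\<close>. The solution with these initial
      values takes that value at \<open>n\<close>, where \<open>Q\<close> is therefore
      \<open>1\<close>.\<close>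
    define p where "p = (\<theta>2 n - \<i> * Im z * \<theta>1 n, \<i> * Im z * \<phi>1 n - \<phi>2 n)"
    have W: "\<phi>1 n * \<theta>2 n = 1 + \<phi>2 n * \<theta>1 n"
      using wronskian_constant[OF \<phi>(1) \<theta>(1), of n] \<phi> \<theta> by (simp add: algebra_simps)
    have "F1 p n = \<phi>1 n * \<theta>2 n - \<phi>2 n * \<theta>1 n" "F2 p n = \<i> * Im z * (\<phi>1 n * \<theta>2 n - \<phi>2 n * \<theta>1 n)"
      by (auto simp: F1_def F2_def p_def algebra_simps)
    then have Fp: "F1 p n = 1" "F2 p n = \<i> * Im z" by (auto simp: W)
    then have "p \<noteq> 0" by (auto simp: F1_def)
    define k where "k = complex_of_real (1 / norm p)"
    have "F1 (scaleR (1 / norm p) p) n = k * F1 p n" "F2 (scaleR (1 / norm p) p) n = k * F2 p n"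
      by (auto simp: F1_def F2_def k_def scaleR_conv_of_real algebra_simps)
    then have "Q (scaleR (1 / norm p) p) n = (1 / norm p)\<^sup>2"
      using z by (simp add: Q_def Fp k_def power2_eq_square)
    then have "scaleR (1 / norm p) p \<in> S n"
      using \<open>p \<noteq> 0\<close> by (simp add: S_def)
    then show "S n \<noteq> {}" by blast
  next
    fix k n :: nat assume "k \<le> n"
    then show "S n \<subseteq> S k"
      using mono[of "real k" "real n"] by (auto simp: S_def Q[of "real k"] Q[of "real n"]) (smt (verit))
  qed
  then obtain p where p: "\<And>n. p \<in> S n" by auto
  have bound: "integral {0..x} (edens (F1 p) (F2 p)) \<le> Q p 0" if "0 \<le> x" for x
  proof -
    obtain n :: nat where "x \<le> real n" using real_arch_simple by blast
    then show ?thesis using mono[OF that, of n p] p[of n] Q[of "real n" p] by (simp add: S_def)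
  qed
  have F0: "F1 p 0 = fst p" "F2 p 0 = snd p" using \<phi> \<theta> by (auto simp: F1_def F2_def)
  let ?f1 = "\<lambda>x. \<phi>1 x + m * \<theta>1 x" and ?f2 = "\<lambda>x. \<phi>2 x + m * \<theta>2 x"
  have solf: "sol z ?f1 ?f2" using sol_lin_comb[OF \<phi>(1) \<theta>(1), of 1 m] by simp
  \<comment> \<open>Otherwise this solution and the one with initial value \<open>(1, m)\<close> are
    independent and both of bounded energy. Division by the Wronskian \<open>D\<close> contradicts
    the limit point property.\<close>
  have par: "snd p = m * fst p"
  proof (rule ccontr)
    define D where "D = snd p - m * fst p"
    assume "snd p \<noteq> m * fst p"
    then have D: "D \<noteq> 0" by (simp add: D_def)
    show False
    proof (rule limit_point[OF solf sol_scale[OF sol[of p], of "1 / D"]])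
      show "?f1 0 * (1 / D * F2 p 0) - ?f2 0 * (1 / D * F1 p 0) = 1"
        using \<phi> \<theta> D by (simp add: F0 field_simps) (simp add: D_def algebra_simps)
      show "integral {0..x} (edens (\<lambda>x. 1 / D * F1 p x) (\<lambda>x. 1 / D * F2 p x)) \<le> (cmod (1 / D))\<^sup>2 * Q p 0"
        if "0 \<le> x" for x
        unfolding edens_scale using bound[OF that] by (simp add: mult_left_mono)
    qed (use K in auto)
  qed
  \<comment> \<open>A zero first entry would force the second to vanish too, which the unit sphere
    excludes.\<close>
  have "fst p \<noteq> 0"
    using p[of 0] par by (cases p) (auto simp: S_def zero_prod_def[symmetric])
  have "F1 p = (\<lambda>x. fst p * ?f1 x)" "F2 p = (\<lambda>x. fst p * ?f2 x)"
    by (auto simp: F1_def F2_def par fun_eq_iff algebra_simps)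
  then have "integral {0..x} (edens (F1 p) (F2 p)) = (cmod (fst p))\<^sup>2 * integral {0..x} (edens ?f1 ?f2)"
    by (simp add: edens_scale)
  moreover have "Q p 0 = (cmod (fst p))\<^sup>2 * (Im m / Im z)"
    unfolding Q_def F0 par cmod_power2 by (simp add: power2_eq_square algebra_simps add_divide_distrib)
  ultimately have "(cmod (fst p))\<^sup>2 * integral {0..x} (edens ?f1 ?f2) \<le> (cmod (fst p))\<^sup>2 * (Im m / Im z)"
    using bound[OF x] by simp
  moreover have "0 < (cmod (fst p))\<^sup>2" using \<open>fst p \<noteq> 0\<close> by simp
  ultimately show ?thesis by (rule mult_left_le_imp_le)
qed

end

section \<open>Estimates for solutions of finite energy\<close>

context canonical_system
begin

abbreviation mass :: "real \<Rightarrow> real" where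
  "mass x \<equiv> integral {0..x} a"

lemma edens_row_le:
  fixes f1 f2 :: "real \<Rightarrow> complex"
  shows "cmod (a t * f1 t + b t * f2 t) \<le> sqrt (a t) * sqrt (edens f1 f2 t)"
    and "cmod (b t * f1 t + c t * f2 t) \<le> sqrt (c t) * sqrt (edens f1 f2 t)"
  unfolding edens_def using qform_row1_le[OF psd] qform_row2_le[OF psd] by auto

lemma coeffs_integrable:
  assumes "0 \<le> x"
  shows "a integrable_on {x..y}" "b integrable_on {x..y}" "c integrable_on {x..y}"
  using abs_integrable_on[OF assms] by (auto intro: absolutely_integrable_imp_integrable)

lemma integral_a_plus_c:
  assumes "0 \<le> x" "x \<le> y"
  shows "integral {x..y} a + integral {x..y} c = y - x"
proof -
  have "integral {x..y} a + integral {x..y} c = integral {x..y} (\<lambda>t. a t + c t)"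
    using coeffs_integrable assms by (simp add: integral_add)
  also have "\<dots> = y - x" using assms by (simp add: trace_1)
  finally show ?thesis .
qed

lemma integral_a_nonneg: "0 \<le> integral {x..y} a" and integral_c_nonneg: "0 \<le> integral {x..y} c"
proof -
  show "0 \<le> integral {x..y} a"
    by (cases "a integrable_on {x..y}") (auto intro: integral_nonneg a_nonneg simp: not_integrable_integral)
  show "0 \<le> integral {x..y} c"
    by (cases "c integrable_on {x..y}") (auto intro: integral_nonneg c_nonneg simp: not_integrable_integral)
qed

lemma integral_c_le: "0 \<le> x \<Longrightarrow> x \<le> y \<Longrightarrow> integral {x..y} c \<le> y - x"
  using integral_a_plus_c[of x y] integral_a_nonneg[of x y] by linarith

lemma mass_diff: "0 \<le> x \<Longrightarrow> x \<le> y \<Longrightarrow> integral {x..y} a = mass y - mass x"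
  using Henstock_Kurzweil_Integration.integral_combine[of 0 x y a] coeffs_integrable[of 0] by simp

lemma mass_mono: "0 \<le> x \<Longrightarrow> x \<le> y \<Longrightarrow> mass x \<le> mass y"
  using mass_diff[of x y] integral_a_nonneg[of x y] by simp

lemma mass_le: "0 \<le> x \<Longrightarrow> mass x \<le> x"
  using integral_a_plus_c[of 0 x] integral_c_nonneg[of 0 x] by simp

section \<open>Increments of a solution whose energy is at most \<open>E0\<close>\<close>

context
  fixes z :: complex and f1 f2 :: "real \<Rightarrow> complex" and E0 :: real
  assumes f: "sol z f1 f2"
    and energy: "\<And>x. 0 \<le> x \<Longrightarrow> integral {0..x} (edens f1 f2) \<le> E0"
begin

lemma energy_interval_le:
  assumes "0 \<le> x" "x \<le> y"
  shows "integral {x..y} (edens f1 f2) \<le> E0"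
proof -
  have "integral {x..y} (edens f1 f2) \<le> integral {0..y} (edens f1 f2)"
    using assms edens_nonneg sol_continuous[OF f] by (intro integral_subset_le edens_integrable) auto
  then show ?thesis using energy[of y] assms by simp
qed

lemma E0_nonneg: "0 \<le> E0"
  using energy[of 0] by simp

text \<open>The derivative of \<open>f1\<close> is at most \<open>|z| * sqrt c\<close> times the
  root of the energy density, and \<open>c\<close> integrates to at most the length of the interval.
  Thus \<open>f1\<close> moves little on short intervals, however large the mass of \<open>a\<close>
  there.\<close>

lemma f1_increment_le:
  assumes xy: "0 \<le> x" "x \<le> y"
  shows "cmod (f1 y - f1 x) \<le> cmod z * (sqrt (y - x) * sqrt E0)"
proof (cases "z = 0")
  case True
  then show ?thesis using sol_increment(1)[OF f xy]
    by (auto dest: has_integral_unique[OF has_integral_0])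
next
  case False
  have "((\<lambda>t. b t * f1 t + c t * f2 t) has_integral ((f1 y - f1 x) / z)) {x..y}"
    using has_integral_mult_right[OF sol_increment(1)[OF f xy], of "1 / z"] False by simp
  then have "cmod ((f1 y - f1 x) / z) \<le> sqrt (integral {x..y} c * integral {x..y} (edens f1 f2))"
    by (rule has_integral_Cauchy_Schwarz)
       (use xy sol_continuous[OF f] c_nonneg edens_nonneg in
         \<open>auto intro!: coeffs_integrable edens_integrable edens_row_le\<close>)
  also have "\<dots> \<le> sqrt ((y - x) * E0)"
    using xy integral_c_le[OF xy] energy_interval_le[OF xy] integral_c_nonneg[of x y] edens_nonneg
      sol_continuous[OF f]
    by (intro real_sqrt_le_mono mult_mono integral_nonneg edens_integrable) auto
  also have "\<dots> = sqrt (y - x) * sqrt E0" by (rule real_sqrt_mult)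
  finally show ?thesis
    using False by (simp add: norm_divide field_simps)
qed

text \<open>The same argument with \<open>a\<close> in place of \<open>c\<close>: the change of
  \<open>f2\<close> is governed by the mass, so \<open>f2\<close> is nearly constant as long as
  little mass has been met.\<close>

lemma f2_increment_le:
  assumes x: "0 \<le> x"
  shows "cmod (f2 x - f2 0) \<le> cmod z * (sqrt (mass x) * sqrt E0)"
proof (cases "z = 0")
  case True
  then show ?thesis using sol_increment(2)[OF f order_refl x]
    by (auto dest: has_integral_unique[OF has_integral_0])
next
  case False
  have "((\<lambda>t. a t * f1 t + b t * f2 t) has_integral ((f2 x - f2 0) / (- z))) {0..x}"
    using has_integral_mult_right[OF sol_increment(2)[OF f order_refl x], of "1 / (- z)"] False by (simp add: add.commute)
  then have "cmod ((f2 x - f2 0) / (- z)) \<le> sqrt (mass x * integral {0..x} (edens f1 f2))"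
    by (rule has_integral_Cauchy_Schwarz)
       (use sol_continuous[OF f] a_nonneg edens_nonneg in
         \<open>auto intro!: coeffs_integrable edens_integrable edens_row_le\<close>)
  also have "\<dots> \<le> sqrt (mass x * E0)"
    using energy[OF x] integral_a_nonneg[of 0 x]
    by (intro real_sqrt_le_mono mult_left_mono) auto
  finally show ?thesis
    using False by (simp add: norm_divide field_simps real_sqrt_mult)
qed

text \<open>While the mass is small the system is close to \<open>f1' = z * f2 0\<close>. The three
  errors come from the off-diagonal entry, bounded by \<open>sqrt (a * c)\<close>, from the change
  of \<open>f2\<close>, and from replacing \<open>c\<close> by \<open>1\<close>.\<close>

lemma f1_linear_approx:
  assumes x: "0 \<le> x"
  shows "cmod (f1 x - f1 0 - z * x * f2 0) \<le> cmod z *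
     (sqrt (mass x) * sqrt x * (cmod (f1 0) + cmod z * (sqrt x * sqrt E0))
      + x * (cmod z * (sqrt (mass x) * sqrt E0)) + mass x * cmod (f2 0))"
proof -
  note cont = sol_continuous[OF f]
  define F where "F = cmod (f1 0) + cmod z * (sqrt x * sqrt E0)"
  define G where "G = cmod z * (sqrt (mass x) * sqrt E0)"
  have "F \<ge> 0" "G \<ge> 0" using x E0_nonneg integral_a_nonneg[of 0 x] by (auto simp: F_def G_def)
  have F: "cmod (f1 t) \<le> F" if "t \<in> {0..x}" for t
  proof -
    have "cmod (f1 t - f1 0) \<le> cmod z * (sqrt t * sqrt E0)"
      using f1_increment_le[of 0 t] that by simp
    also have "\<dots> \<le> cmod z * (sqrt x * sqrt E0)"
      using that E0_nonneg by (intro mult_left_mono mult_right_mono) auto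
    finally show ?thesis using norm_triangle_sub[of "f1 t" "f1 0"] by (simp add: F_def)
  qed
  have G: "cmod (f2 t - f2 0) \<le> G" if "t \<in> {0..x}" for t
  proof -
    have "cmod (f2 t - f2 0) \<le> cmod z * (sqrt (mass t) * sqrt E0)"
      using f2_increment_le[of t] that by simp
    also have "\<dots> \<le> G"
      unfolding G_def using that mass_mono[of t x] E0_nonneg by (intro mult_left_mono mult_right_mono) auto
    finally show ?thesis .
  qed
  define I1 where "I1 = integral {0..x} (\<lambda>t. b t * f1 t)"
  define I2 where "I2 = integral {0..x} (\<lambda>t. c t * (f2 t - f2 0))"
  have cont': "continuous_on {0..x} f1" "continuous_on {0..x} (\<lambda>t. f2 t - f2 0)"
    using cont by (auto intro!: continuous_intros intro: continuous_on_subset)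
  have i1: "((\<lambda>t. b t * f1 t) has_integral I1) {0..x}"
    unfolding I1_def using cont' abs_integrable
    by (intro integrable_integral absolutely_integrable_imp_integrable
        absolutely_integrable_times_continuous absolutely_integrable_complex_of_real)
  have i2: "((\<lambda>t. c t * (f2 t - f2 0)) has_integral I2) {0..x}"
    unfolding I2_def using cont' abs_integrable
    by (intro integrable_integral absolutely_integrable_imp_integrable
        absolutely_integrable_times_continuous absolutely_integrable_complex_of_real)
  have c_int: "(c has_integral (x - mass x)) {0..x}"
    using coeffs_integrable(3)[of 0 x] integral_a_plus_c[of 0 x] x
    by (metis add_diff_cancel_left' diff_zero integrable_integral order_refl)
  then have i3: "((\<lambda>t. complex_of_real (c t) * f2 0) has_integral (of_real (x - mass x) * f2 0)) {0..x}"
    by (intro has_integral_mult_left has_integral_of_real)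
  have "((\<lambda>t. z * (b t * f1 t + c t * (f2 t - f2 0) + c t * f2 0)) has_integral
      z * (I1 + I2 + of_real (x - mass x) * f2 0)) {0..x}"
    by (intro has_integral_mult_right has_integral_add i1 i2 i3)
  then have "((\<lambda>t. z * (b t * f1 t + c t * f2 t)) has_integral
      z * (I1 + I2 + of_real (x - mass x) * f2 0)) {0..x}"
    by (simp add: algebra_simps)
  then have "f1 x - f1 0 = z * (I1 + I2 + of_real (x - mass x) * f2 0)"
    using sol_increment(1)[OF f order_refl x] has_integral_unique by blast
  then have eq: "f1 x - f1 0 - z * x * f2 0 = z * (I1 + I2 - of_real (mass x) * f2 0)"
    by (simp add: algebra_simps)
  have "cmod I1 \<le> sqrt (mass x * integral {0..x} (\<lambda>t. F\<^sup>2 * c t))"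
  proof (rule has_integral_Cauchy_Schwarz[OF i1])
    fix t assume t: "t \<in> {0..x}"
    have "\<bar>b t\<bar> \<le> sqrt (a t * c t)"
      using det_nonneg[of t] by (simp add: real_le_rsqrt)
    then have "\<bar>b t\<bar> * cmod (f1 t) \<le> sqrt (a t * c t) * F"
      using F[OF t] by (intro mult_mono) (auto simp: a_nonneg c_nonneg)
    then show "cmod (b t * f1 t) \<le> sqrt (a t) * sqrt (F\<^sup>2 * c t)"
      using \<open>F \<ge> 0\<close> by (simp add: norm_mult real_sqrt_mult mult_ac)
  qed (use coeffs_integrable a_nonneg c_nonneg in \<open>auto intro: integrable_on_mult_right\<close>)
  also have "\<dots> = sqrt (mass x) * sqrt (integral {0..x} c) * F"
    using \<open>F \<ge> 0\<close> by (simp add: real_sqrt_mult)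
  also have "\<dots> \<le> sqrt (mass x) * sqrt x * F"
    using integral_c_le[of 0 x] x \<open>F \<ge> 0\<close> integral_a_nonneg[of 0 x]
    by (intro mult_right_mono mult_left_mono) auto
  finally have I1: "cmod I1 \<le> sqrt (mass x) * sqrt x * F" .
  have "cmod I2 \<le> integral {0..x} (\<lambda>t. c t * G)"
    unfolding I2_def
  proof (rule integral_norm_bound_integral)
    show "cmod (c t * (f2 t - f2 0)) \<le> c t * G" if "t \<in> {0..x}" for t
      using G[OF that] c_nonneg[of t] by (simp add: norm_mult mult_left_mono)
  qed (use i2 coeffs_integrable(3)[of 0 x] in \<open>auto intro: integrable_on_mult_left\<close>)
  also have "\<dots> = integral {0..x} c * G" by simp
  also have "\<dots> \<le> x * G" using integral_c_le[of 0 x] x \<open>G \<ge> 0\<close> by (intro mult_right_mono) auto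
  finally have I2: "cmod I2 \<le> x * G" .
  have "cmod (I1 + I2 - of_real (mass x) * f2 0) \<le> sqrt (mass x) * sqrt x * F + x * G + mass x * cmod (f2 0)"
    using I1 I2 integral_a_nonneg[of 0 x]
    by (intro order_trans[OF norm_triangle_ineq4] add_mono order_trans[OF norm_triangle_ineq])
       (auto simp: norm_mult)
  then show ?thesis
    unfolding eq norm_mult F_def G_def by (rule mult_left_mono) simp
qed

text \<open>Where \<open>f1\<close> stays away from \<open>0\<close>, the energy must pay for the
  mass of \<open>a\<close>, up to a correction by \<open>c * |f2|\<^sup>2\<close>. The factor
  \<open>y - x\<close> on that correction is decisive, since the bound on \<open>f2\<close> contains
  \<open>sqrt (mass y)\<close>.\<close>

lemma mass_first_component_le:
  assumes xy: "0 \<le> x" "x \<le> y" and k: "0 \<le> k" "\<And>t. t \<in> {x..y} \<Longrightarrow> k \<le> cmod (f1 t)"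
  shows "k\<^sup>2 * (mass y - mass x) \<le>
    2 * E0 + 2 * (y - x) * (cmod (f2 0) + cmod z * (sqrt (mass y) * sqrt E0))\<^sup>2"
proof -
  note cont = sol_continuous[OF f]
  define G where "G = cmod (f2 0) + cmod z * (sqrt (mass y) * sqrt E0)"
  have G: "cmod (f2 t) \<le> G" if "t \<in> {x..y}" for t
  proof -
    have "cmod (f2 t - f2 0) \<le> cmod z * (sqrt (mass t) * sqrt E0)"
      using f2_increment_le[of t] that xy by simp
    also have "\<dots> \<le> cmod z * (sqrt (mass y) * sqrt E0)"
      using that xy mass_mono[of t y] E0_nonneg by (intro mult_left_mono mult_right_mono) auto
    finally show ?thesis using norm_triangle_sub[of "f2 t" "f2 0"] by (simp add: G_def)
  qed
  have "k\<^sup>2 * integral {x..y} a = integral {x..y} (\<lambda>t. k\<^sup>2 * a t)" by simp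
  also have "\<dots> \<le> integral {x..y} (\<lambda>t. 2 * edens f1 f2 t + 2 * G\<^sup>2 * c t)"
  proof (rule integral_le)
    fix t assume t: "t \<in> {x..y}"
    have "k\<^sup>2 * a t \<le> (cmod (f1 t))\<^sup>2 * a t"
      using k t a_nonneg by (intro mult_right_mono power_mono) auto
    also have "\<dots> \<le> 2 * edens f1 f2 t + 2 * c t * (cmod (f2 t))\<^sup>2"
      using qform_diag1_le[OF psd, of t "f1 t" "f2 t"]
      unfolding edens_def by (simp add: mult.commute)
    also have "\<dots> \<le> 2 * edens f1 f2 t + 2 * c t * G\<^sup>2"
      using G[OF t] c_nonneg[of t] by (intro add_left_mono mult_left_mono power_mono) auto
    finally show "k\<^sup>2 * a t \<le> 2 * edens f1 f2 t + 2 * G\<^sup>2 * c t" by (simp add: mult_ac)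
  qed (use xy cont coeffs_integrable edens_integrable in \<open>auto intro!: integrable_add integrable_on_mult_right\<close>)
  also have "\<dots> = 2 * integral {x..y} (edens f1 f2) + 2 * G\<^sup>2 * integral {x..y} c"
    using xy cont coeffs_integrable edens_integrable
    by (subst integral_add) (auto intro!: integrable_on_mult_right)
  also have "\<dots> \<le> 2 * E0 + 2 * G\<^sup>2 * (y - x)"
    using energy_interval_le[OF xy] integral_c_le[OF xy] by (intro add_mono mult_left_mono) auto
  finally show ?thesis
    unfolding mass_diff[OF xy, symmetric] G_def[symmetric] by (simp only: mult_ac)
qed

end

text \<open>The preceding estimates in the scale where \<open>X = w\<^sup>2\<close> has unit length and
  \<open>mass X = s\<^sup>2\<close> is the unit of mass.\<close>

lemma rescaled_estimate:
  fixes w s e \<eta> \<rho> \<kappa> :: real and \<mu> M :: complex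
  assumes f: "sol z f1 f2" and init: "f1 0 = 1" "f2 0 = M * of_real (s / w)"
    and energy: "\<And>x. 0 \<le> x \<Longrightarrow> integral {0..x} (edens f1 f2) \<le> (e * s)\<^sup>2"
    and pos: "w > 0" "s > 0" "e \<ge> 0" "0 < \<eta>" "\<eta> < 1"
    and z: "z = \<mu> / of_real (w * s)"
    and mass: "mass (w\<^sup>2) = s\<^sup>2" "mass ((1 - \<eta>) * w\<^sup>2) = \<rho> * s\<^sup>2" "mass ((1 + \<eta>) * w\<^sup>2) = \<kappa> * s\<^sup>2"
  defines "\<delta> \<equiv> cmod \<mu> * sqrt \<rho> * (1 + 2 * cmod \<mu> * e) + cmod \<mu> * cmod M * (s\<^sup>2 / w\<^sup>2)
      + \<eta> * cmod \<mu> * cmod M + cmod \<mu> * sqrt (2 * \<eta>) * e"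
  assumes \<delta>: "\<delta> \<le> cmod (1 + \<mu> * M)"
  shows "(cmod (1 + \<mu> * M) - \<delta>)\<^sup>2 * (\<kappa> - \<rho>) \<le> 2 * e\<^sup>2 + 4 * \<eta> * (cmod M + cmod \<mu> * sqrt \<kappa> * e)\<^sup>2"
proof -
  define x0 where "x0 = (1 - \<eta>) * w\<^sup>2"
  define x1 where "x1 = (1 + \<eta>) * w\<^sup>2"
  have x: "0 \<le> x0" "x0 \<le> x1" "x0 \<le> w\<^sup>2"
    using pos by (auto simp: x0_def x1_def intro!: mult_right_mono)
  have sqE: "sqrt ((e * s)\<^sup>2) = e * s" using pos by simp
  have m0: "0 \<le> \<rho>" "\<rho> \<le> 1"
    using integral_a_nonneg[of 0 x0] mass_mono[OF x(1) x(3)] pos mass by (auto simp: x0_def zero_le_mult_iff)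
  have zn: "cmod z = cmod \<mu> / (w * s)" using pos by (simp add: z norm_divide norm_mult)
  have sqx0: "sqrt x0 \<le> w" using x pos real_sqrt_le_mono[OF x(3)] by simp
  have sqm0: "sqrt (mass x0) = sqrt \<rho> * s" using mass pos by (simp add: x0_def real_sqrt_mult)
  have sqm1: "sqrt (mass x1) = sqrt \<kappa> * s" using mass pos by (simp add: x1_def real_sqrt_mult)
  have "cmod (f1 x0 - f1 0 - z * x0 * f2 0) \<le> cmod z *
     (sqrt (mass x0) * sqrt x0 * (cmod (f1 0) + cmod z * (sqrt x0 * sqrt ((e * s)\<^sup>2)))
      + x0 * (cmod z * (sqrt (mass x0) * sqrt ((e * s)\<^sup>2))) + mass x0 * cmod (f2 0))"
    by (rule f1_linear_approx[OF f energy x(1)])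
  also have "\<dots> \<le> cmod z * ((sqrt \<rho> * s) * w * (1 + cmod z * (w * (e * s)))
      + w\<^sup>2 * (cmod z * ((sqrt \<rho> * s) * (e * s))) + s\<^sup>2 * (cmod M * (s / w)))"
    unfolding sqE sqm0 using sqx0 x pos m0 mass
    by (intro mult_left_mono add_mono mult_mono)
       (auto simp: init norm_mult norm_divide x0_def intro: mult_right_mono mult_left_le_one_le)
  also have "\<dots> = cmod \<mu> * sqrt \<rho> * (1 + 2 * cmod \<mu> * e) + cmod \<mu> * cmod M * (s\<^sup>2 / w\<^sup>2)"
    unfolding zn using pos by (simp add: field_simps power2_eq_square)
  finally have A1: "cmod (f1 x0 - f1 0 - z * x0 * f2 0)
      \<le> cmod \<mu> * sqrt \<rho> * (1 + 2 * cmod \<mu> * e) + cmod \<mu> * cmod M * (s\<^sup>2 / w\<^sup>2)" .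
  \<comment> \<open>The approximation stops at \<open>1 - \<eta>\<close>; the missing
    \<open>\<eta> * (\<mu> * M)\<close> becomes the third term of \<open>\<delta>\<close>.\<close>
  have zx: "z * x0 * f2 0 = (1 - \<eta>) * (\<mu> * M)"
    unfolding z x0_def init using pos by (simp add: field_simps power2_eq_square)
  have A2: "cmod (f1 t - f1 x0) \<le> cmod \<mu> * sqrt (2 * \<eta>) * e" if t: "t \<in> {x0..x1}" for t
  proof -
    have "cmod (f1 t - f1 x0) \<le> cmod z * (sqrt (t - x0) * sqrt ((e * s)\<^sup>2))"
      using f1_increment_le[OF f energy] t x by auto
    also have "\<dots> \<le> cmod z * (sqrt (2 * \<eta> * w\<^sup>2) * (e * s))"
      unfolding sqE using t pos
      by (intro mult_left_mono mult_right_mono real_sqrt_le_mono) (auto simp: x0_def x1_def algebra_simps)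
    also have "\<dots> = cmod \<mu> * sqrt (2 * \<eta>) * e"
      unfolding zn using pos by (simp add: real_sqrt_mult)
    finally show ?thesis .
  qed
  \<comment> \<open>\<open>1 + \<mu> * M\<close> is the linear approximation of \<open>f1\<close> at
    unit time. Its distance to \<open>f1 t\<close> throughout the window is at most
    \<open>\<delta>\<close>: linearization before \<open>x0\<close>, the gap of length
    \<open>\<eta>\<close>, and the motion of \<open>f1\<close> inside the window.\<close>
  have low: "cmod (1 + \<mu> * M) - \<delta> \<le> cmod (f1 t)" if t: "t \<in> {x0..x1}" for t
  proof -
    have "1 + \<mu> * M = f1 t - (f1 t - f1 x0) - (f1 x0 - f1 0 - z * x0 * f2 0) + \<eta> * (\<mu> * M)"
      unfolding zx by (simp add: init algebra_simps)
    also have "cmod \<dots> \<le> cmod (f1 t) + cmod (f1 t - f1 x0) + cmod (f1 x0 - f1 0 - z * x0 * f2 0)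
        + cmod (\<eta> * (\<mu> * M))"
      by (intro order_trans[OF norm_triangle_ineq] add_mono order_trans[OF norm_triangle_ineq4] order_refl)
    finally show ?thesis
      using A1 A2[OF t] pos by (simp add: \<delta>_def norm_mult)
  qed
  have "(cmod (1 + \<mu> * M) - \<delta>)\<^sup>2 * (mass x1 - mass x0) \<le>
    2 * (e * s)\<^sup>2 + 2 * (x1 - x0) * (cmod (f2 0) + cmod z * (sqrt (mass x1) * sqrt ((e * s)\<^sup>2)))\<^sup>2"
    using \<delta> low by (intro mass_first_component_le[OF f energy x(1,2)]) auto
  also have "\<dots> = (2 * e\<^sup>2 + 4 * \<eta> * (cmod M + cmod \<mu> * sqrt \<kappa> * e)\<^sup>2) * s\<^sup>2"
  proof -
    define P where "P = cmod M + cmod \<mu> * sqrt \<kappa> * e"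
    have *: "cmod (f2 0) + cmod z * (sqrt (mass x1) * sqrt ((e * s)\<^sup>2)) = P * (s / w)"
      unfolding sqE sqm1 zn init P_def using pos by (simp add: norm_mult norm_divide field_simps)
    have **: "x1 - x0 = 2 * \<eta> * w\<^sup>2" by (simp add: x0_def x1_def algebra_simps)
    show ?thesis
      unfolding * ** P_def[symmetric]
      using pos by (simp add: power_mult_distrib power_divide algebra_simps)
  qed
  also have "mass x1 - mass x0 = (\<kappa> - \<rho>) * s\<^sup>2"
    using mass by (simp add: x0_def x1_def algebra_simps)
  finally show ?thesis
    using pos by (simp flip: mult.assoc)
qed

end

text \<open>A bootstrap in real numbers, with \<open>T\<close> for \<open>|1 + \<mu> M|\<close> and
  \<open>\<mu>\<close>, \<open>M\<close> for moduli. All errors are linear in \<open>1 + M\<close>,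
  and \<open>M\<close> is bounded by \<open>(1 + T) / \<beta>\<close>; small \<open>\<tau>\<close>
  therefore lets half of \<open>T\<close> be absorbed.\<close>

lemma rescaled_conclusion:
  fixes T \<mu> M \<rho> \<kappa> \<sigma> \<eta> B \<beta> e \<delta> :: real
  assumes \<mu>: "0 \<le> \<mu>" "\<mu> \<le> B" "1 \<le> B" and \<beta>: "\<beta> > 0" "\<beta> * M \<le> 1 + T" and M: "0 \<le> M" "0 \<le> T"
    and e: "e = sqrt (M / \<beta>)" and \<eta>: "0 < \<eta>" "\<eta> < 1" and \<rho>: "0 \<le> \<rho>" "\<rho> \<le> 1 / 2" and \<kappa>: "1 \<le> \<kappa>" "4 / \<kappa> \<le> \<eta>"
    and \<sigma>: "0 \<le> \<sigma>"
    and \<delta>: "\<delta> = \<mu> * sqrt \<rho> * (1 + 2 * \<mu> * e) + \<mu> * M * \<sigma> + \<eta> * \<mu> * M + \<mu> * sqrt (2 * \<eta>) * e"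
    and est: "\<delta> \<le> T \<Longrightarrow> (T - \<delta>)\<^sup>2 * (\<kappa> - \<rho>) \<le> 2 * e\<^sup>2 + 4 * \<eta> * (M + \<mu> * sqrt \<kappa> * e)\<^sup>2"
  defines "D \<equiv> 1 + 1 / \<beta>"
  defines "\<tau> \<equiv> 3 * B\<^sup>2 * D * sqrt \<rho> + B * \<sigma> + \<eta> * B + 2 * B * D * sqrt \<eta> + 6 * D * B * sqrt \<eta>"
  assumes small: "2 * D * \<tau> \<le> \<epsilon>" "2 * D * \<tau> \<le> 1"
  shows "T \<le> \<epsilon>"
proof -
  define Y where "Y = 1 + M"
  have D: "1 \<le> D" "D > 0" and Y: "1 \<le> Y" "M \<le> Y" using \<beta> M by (auto simp: D_def Y_def add_pos_pos)
  have B0: "0 \<le> B" using \<mu> by simp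
  \<comment> \<open>\<open>e\<close> grows only like \<open>sqrt M\<close>, but a bound linear in
    \<open>Y = 1 + M\<close> puts it on the same footing as the other errors.\<close>
  have "sqrt (M / \<beta>) \<le> sqrt ((D * Y)\<^sup>2)"
  proof (rule real_sqrt_le_mono)
    have "M / \<beta> \<le> D * Y"
      using \<beta> M by (simp add: D_def Y_def field_simps)
    also have "\<dots> \<le> (D * Y) * (D * Y)"
      using D Y mult_mono[of 1 D 1 Y] by (intro mult_le_cancel_left1[THEN iffD2]) auto
    finally show "M / \<beta> \<le> (D * Y)\<^sup>2" by (simp add: power2_eq_square)
  qed
  then have e: "0 \<le> e" "e \<le> D * Y" using D Y \<beta> M by (auto simp: e)
  \<comment> \<open>Absorbs the constant \<open>1\<close> in \<open>1 + 2 * \<mu> * e\<close>, which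
    explains the coefficient \<open>3\<close> in \<open>\<tau>\<close>.\<close>
  have YD: "1 \<le> B * (D * Y)" using \<mu> D Y by (metis mult_mono' mult_1 zero_le_one)
  have "\<mu> * sqrt \<rho> * (1 + 2 * \<mu> * e) \<le> B * sqrt \<rho> * (B * (D * Y) + 2 * B * (D * Y))"
    using \<mu> e \<rho> YD B0 D Y by (intro mult_mono add_mono) auto
  moreover have "\<mu> * M * \<sigma> \<le> B * Y * \<sigma>" using \<mu> M Y \<sigma> by (intro mult_mono) auto
  moreover have "\<eta> * \<mu> * M \<le> \<eta> * B * Y" using \<mu> M Y \<eta> by (intro mult_mono) auto
  moreover have "\<mu> * sqrt (2 * \<eta>) * e \<le> B * (2 * sqrt \<eta>) * (D * Y)"
  proof -
    have "sqrt (2 * \<eta>) \<le> sqrt (2\<^sup>2 * \<eta>)" using \<eta> by (intro real_sqrt_le_mono) auto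
    then have "sqrt (2 * \<eta>) \<le> 2 * sqrt \<eta>" by (simp add: real_sqrt_mult)
    then show ?thesis using \<mu> e \<eta> B0 by (intro mult_mono) auto
  qed
  ultimately have \<delta>Y: "\<delta> \<le> (3 * B\<^sup>2 * D * sqrt \<rho> + B * \<sigma> + \<eta> * B + 2 * B * D * sqrt \<eta>) * Y"
    unfolding \<delta> by (simp add: power2_eq_square algebra_simps)
  have T\<delta>: "T - \<delta> \<le> 6 * D * B * sqrt \<eta> * Y"
  proof (cases "\<delta> \<le> T")
    case True
    have e2: "e\<^sup>2 \<le> (B * D * Y)\<^sup>2"
    proof (rule power_mono)
      have "e \<le> 1 * (D * Y)" using e by simp
      also have "\<dots> \<le> B * (D * Y)" using \<mu> D Y by (intro mult_right_mono) auto
      finally show "e \<le> B * D * Y" by simp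
    qed (use e in auto)
    have "M + \<mu> * sqrt \<kappa> * e \<le> 2 * (B * D * Y * sqrt \<kappa>)"
    proof -
      have "M \<le> 1 * 1 * Y * 1" using Y by simp
      also have "\<dots> \<le> B * D * Y * sqrt \<kappa>" using \<mu> D Y \<kappa> by (intro mult_mono) auto
      finally have "M \<le> B * D * Y * sqrt \<kappa>" .
      moreover have "\<mu> * sqrt \<kappa> * e \<le> B * sqrt \<kappa> * (D * Y)"
        using \<mu> e \<kappa> B0 by (intro mult_mono) auto
      ultimately show ?thesis by (simp add: mult_ac)
    qed
    then have "(M + \<mu> * sqrt \<kappa> * e)\<^sup>2 \<le> (2 * (B * D * Y * sqrt \<kappa>))\<^sup>2"
      using M \<mu> e \<kappa> by (intro power_mono) auto
    also have "\<dots> = 4 * \<kappa> * (B * D * Y)\<^sup>2"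
      using \<kappa> by (simp add: power_mult_distrib)
    finally have m2: "(M + \<mu> * sqrt \<kappa> * e)\<^sup>2 \<le> 4 * \<kappa> * (B * D * Y)\<^sup>2" .
    \<comment> \<open>From \<open>\<rho> \<le> 1 / 2\<close> and \<open>1 \<le> \<kappa>\<close>, at
      least half of \<open>\<kappa>\<close> remains; both sides then share the factor
      \<open>\<kappa> / 2\<close>, which cancels.\<close>
    have "(T - \<delta>)\<^sup>2 * (\<kappa> / 2) \<le> (T - \<delta>)\<^sup>2 * (\<kappa> - \<rho>)"
      using \<kappa> \<rho> by (intro mult_left_mono) auto
    also have "\<dots> \<le> 2 * e\<^sup>2 + 4 * \<eta> * (M + \<mu> * sqrt \<kappa> * e)\<^sup>2" by (rule est[OF True])
    also have "\<dots> \<le> 2 * (B * D * Y)\<^sup>2 + 4 * \<eta> * (4 * \<kappa> * (B * D * Y)\<^sup>2)"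
      using e2 m2 \<eta> by (intro add_mono mult_left_mono) auto
    also have "\<dots> = (B * D * Y)\<^sup>2 * (4 / \<kappa> + 32 * \<eta>) * (\<kappa> / 2)"
      using \<kappa> by (simp add: field_simps)
    \<comment> \<open>\<open>4 / \<kappa> \<le> \<eta>\<close> gives \<open>33 * \<eta>\<close>,
      rounded up to \<open>36 * \<eta>\<close> to make the root
      \<open>6 * sqrt \<eta>\<close>.\<close>
    also have "\<dots> \<le> (B * D * Y)\<^sup>2 * (36 * \<eta>) * (\<kappa> / 2)"
      using \<kappa> \<eta> by (intro mult_right_mono mult_left_mono) auto
    finally have "(T - \<delta>)\<^sup>2 \<le> (B * D * Y)\<^sup>2 * (36 * \<eta>)"
      using \<kappa> by (simp add: mult_ac)
    also have "\<dots> = (6 * D * B * sqrt \<eta> * Y)\<^sup>2"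
      using \<eta> by (simp add: power_mult_distrib)
    finally show ?thesis
      by (rule power2_le_imp_le) (use B0 D Y \<eta> in auto)
  next
    case False
    have "0 \<le> 6 * D * B * sqrt \<eta> * Y" using B0 D Y \<eta> by auto
    then show ?thesis using False by linarith
  qed
  have \<tau>0: "0 \<le> \<tau>" using B0 D \<eta> \<rho> \<sigma> by (auto simp: \<tau>_def)
  have "T \<le> \<tau> * Y" using \<delta>Y T\<delta> by (simp add: \<tau>_def algebra_simps)
  also have "\<dots> \<le> \<tau> * (D * (1 + T))"
  proof -
    have "M \<le> (1 + T) / \<beta>" using \<beta> by (simp add: field_simps)
    then have "Y \<le> D * (1 + T)" using M by (simp add: Y_def D_def algebra_simps add_divide_distrib)
    then show ?thesis using \<tau>0 by (intro mult_left_mono)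
  qed
  also have "\<dots> = D * \<tau> + (D * \<tau>) * T" by (simp add: algebra_simps)
  also have "\<dots> \<le> D * \<tau> + (1 / 2) * T"
    using small M by (intro add_left_mono mult_right_mono) auto
  finally show ?thesis using small by simp
qed

section \<open>Rapidly varying mass\<close>

context canonical_system
begin

context
  assumes mass_pos: "\<And>x. 0 < x \<Longrightarrow> 0 < mass x"
begin

lemma mult_mass_strict_mono:
  assumes "0 < x" "x < y"
  shows "x * mass x < y * mass y"
proof -
  have "x * mass x < y * mass x" using assms mass_pos[of x] by simp
  also have "\<dots> \<le> y * mass y" using assms mass_mono[of x y] by simp
  finally show ?thesis .
qed

lemma inj_on_inverse_mult_mass: "inj_on (\<lambda>x. 1 / (x * mass x)) {0<..}"
proof (rule linorder_inj_onI)
  fix x y :: real assume "x < y" "x \<in> {0<..}" "y \<in> {0<..}"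
  then show "1 / (x * mass x) \<noteq> 1 / (y * mass y)"
    using mult_mass_strict_mono[of x y] by (auto simp: divide_simps)
qed auto

lemma inverse_mult_mass_surj:
  assumes "0 < v"
  shows "v \<in> (\<lambda>x. 1 / (x * mass x)) ` {0<..}"
proof -
  \<comment> \<open>Bracketing for the intermediate value theorem: \<open>mass l \<le> l\<close>
    makes \<open>l * mass l \<le> 1 / v\<close>, and \<open>mass u \<ge> mass 1\<close> makes
    \<open>u * mass u \<ge> 1 / v\<close>.\<close>
  define l where "l = min 1 (sqrt (1 / v))"
  define u where "u = max 1 (1 / (v * mass 1))"
  have m1: "0 < mass 1" by (rule mass_pos) simp
  have l: "0 < l" "l \<le> 1" "l \<le> sqrt (1 / v)" and u: "1 \<le> u" "1 / (v * mass 1) \<le> u"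
    using assms by (auto simp: l_def u_def)
  have "l * mass l \<le> l * l" using l mass_le[of l] by simp
  also have "\<dots> \<le> sqrt (1 / v) * sqrt (1 / v)" using l assms by (intro mult_mono) auto
  finally have lo: "l * mass l \<le> 1 / v" using assms by simp
  have "1 / v = 1 / (v * mass 1) * mass 1" using m1 by simp
  also have "\<dots> \<le> u * mass u" using u m1 mass_mono[of 1 u] by (intro mult_mono) auto
  finally have hi: "1 / v \<le> u * mass u" .
  have "continuous_on {l..u} mass"
    using indefinite_integral_continuous_1[OF coeffs_integrable(1)[of 0 u]] l
    by (auto intro: continuous_on_subset)
  then have "continuous_on {l..u} (\<lambda>x. x * mass x)" by (intro continuous_intros)
  then obtain x where x: "l \<le> x" "x \<le> u" "x * mass x = 1 / v"
    using IVT'[of "\<lambda>x. x * mass x" l "1 / v" u] lo hi l u by auto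
  then have "v = 1 / (x * mass x)" by simp
  then show ?thesis using x l by (intro image_eqI[of _ _ x]) auto
qed

section \<open>The scale \<open>X r\<close> and the limits of the rescaled mass\<close>

context
  fixes X :: "real \<Rightarrow> real"
  assumes X: "\<And>r. 0 < r \<Longrightarrow> 0 < X r" "\<And>r. 0 < r \<Longrightarrow> 1 / (X r * mass (X r)) = r\<^sup>2"
    and rapid: "\<And>t. 1 < t \<Longrightarrow> filterlim (\<lambda>y. mass y / mass (y / t)) at_top (at_right 0)"
begin

lemma scale_tendsto_0: "filterlim X (at_right 0) at_top"
proof (rule tendsto_imp_filterlim_at_right)
  show ev: "\<forall>\<^sub>F r in at_top. 0 < X r"
    using eventually_gt_at_top[of 0] by eventually_elim (rule X)
  show "(X \<longlongrightarrow> 0) at_top"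
  proof (rule order_tendstoI)
    fix u :: real assume "u < 0"
    then show "\<forall>\<^sub>F r in at_top. u < X r" using ev by (auto elim: eventually_mono)
  next
    fix u :: real assume u: "0 < u"
    \<comment> \<open>If \<open>X r \<ge> u\<close>, then
      \<open>r\<^sup>2 \<le> 1 / (u * mass u) < r\<close>, which fails for
      \<open>r > 1\<close>.\<close>
    have "\<forall>\<^sub>F r in at_top. max 1 (1 / (u * mass u)) < r" by (rule eventually_gt_at_top)
    then show "\<forall>\<^sub>F r in at_top. X r < u"
    proof eventually_elim
      case (elim r)
      show ?case
      proof (rule ccontr)
        assume "\<not> X r < u"
        then have "0 < X r" using u by simp
        have "u * mass u \<le> X r * mass (X r)"
          using \<open>\<not> X r < u\<close> u mass_mono[of u "X r"] mass_pos[of u] by (intro mult_mono) auto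
        then have "1 / (X r * mass (X r)) \<le> 1 / (u * mass u)"
          using u mass_pos \<open>0 < X r\<close> by (intro divide_left_mono) (auto intro: mult_pos_pos)
        then have "r\<^sup>2 < r" using X(2)[of r] elim by simp
        then show False using elim by (simp add: power2_eq_square)
      qed
    qed
  qed
qed

lemma mass_ratio_below:
  assumes "0 < \<eta>" "\<eta> < 1"
  shows "((\<lambda>r. mass ((1 - \<eta>) * X r) / mass (X r)) \<longlongrightarrow> 0) at_top"
proof -
  have "filterlim (\<lambda>r. mass (X r) / mass (X r / (1 / (1 - \<eta>)))) at_top at_top"
    using assms by (intro filterlim_compose[OF rapid scale_tendsto_0]) simp
  then show ?thesis
    using tendsto_inverse_0_at_top[of "\<lambda>r. mass (X r) / mass (X r / (1 / (1 - \<eta>)))"]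
    by (simp add: mult.commute)
qed

lemma mass_ratio_above:
  assumes "0 < \<eta>"
  shows "filterlim (\<lambda>r. mass ((1 + \<eta>) * X r) / mass (X r)) at_top at_top"
proof -
  have "filterlim (\<lambda>r. (1 + \<eta>) * X r) (at_right 0) at_top"
  proof (rule tendsto_imp_filterlim_at_right)
    have "(X \<longlongrightarrow> 0) at_top" using scale_tendsto_0 by (simp add: filterlim_at)
    then show "((\<lambda>r. (1 + \<eta>) * X r) \<longlongrightarrow> 0) at_top" by (rule tendsto_mult_right_zero)
    show "\<forall>\<^sub>F r in at_top. 0 < (1 + \<eta>) * X r"
      using eventually_gt_at_top[of 0] by eventually_elim (use X assms in simp)
  qed
  then have "filterlim (\<lambda>r. mass ((1 + \<eta>) * X r) / mass ((1 + \<eta>) * X r / (1 + \<eta>))) at_top at_top"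
    using assms by (intro filterlim_compose[OF rapid]) simp_all
  then show ?thesis using assms by simp
qed

text \<open>Trace norming gives \<open>mass (2 * X r) \<le> 2 * X r\<close>, and rapid variation
  makes \<open>mass (X r)\<close> negligible against \<open>mass (2 * X r)\<close>. This ratio
  measures the error of replacing \<open>c\<close> by \<open>1\<close>.\<close>

lemma mass_over_scale: "((\<lambda>r. mass (X r) / X r) \<longlongrightarrow> 0) at_top"
proof (rule tendsto_sandwich[where f = "\<lambda>_. 0"])
  have "((\<lambda>r. inverse (mass ((1 + 1) * X r) / mass (X r))) \<longlongrightarrow> 0) at_top"
    using mass_ratio_above[of 1] by (intro tendsto_inverse_0_at_top) simp
  then show "((\<lambda>r. 2 * inverse (mass ((1 + 1) * X r) / mass (X r))) \<longlongrightarrow> 0) at_top"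
    by (rule tendsto_mult_right_zero)
  show "\<forall>\<^sub>F r in at_top. 0 \<le> mass (X r) / X r"
    using eventually_gt_at_top[of 0] by eventually_elim (auto simp: X mass_pos less_imp_le)
  show "\<forall>\<^sub>F r in at_top. mass (X r) / X r \<le> 2 * inverse (mass ((1 + 1) * X r) / mass (X r))"
    using eventually_gt_at_top[of 0]
  proof eventually_elim
    case (elim r)
    have "mass (2 * X r) \<le> 2 * X r" "0 < mass (2 * X r)" "0 < mass (X r)"
      using X(1)[OF elim] mass_le[of "2 * X r"] mass_pos by auto
    then have "mass (X r) / X r \<le> mass (X r) / (mass (2 * X r) / 2)"
      using X(1)[OF elim] by (intro divide_left_mono) auto
    then show ?case by (simp add: mult.commute)
  qed
qed simp

text \<open>Uniformity holds because \<open>S\<close> enters only through an upper bound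
  \<open>B\<close> on \<open>|\<mu>|\<close> and a positive lower bound \<open>\<beta>\<close> on
  \<open>|Im \<mu>|\<close>. All thresholds for \<open>r\<close> depend on these and on
  \<open>\<epsilon>\<close> and \<open>\<eta>\<close>.\<close>

lemma m_function_asymptotics:
  fixes \<phi>1 \<phi>2 \<theta>1 \<theta>2 :: "complex \<Rightarrow> real \<Rightarrow> complex" and m :: "complex \<Rightarrow> complex" and S :: "complex set"
  assumes \<phi>: "\<And>z. sol z (\<phi>1 z) (\<phi>2 z)" "\<And>z. \<phi>1 z 0 = 1" "\<And>z. \<phi>2 z 0 = 0"
    and \<theta>: "\<And>z. sol z (\<theta>1 z) (\<theta>2 z)" "\<And>z. \<theta>1 z 0 = 0" "\<And>z. \<theta>2 z 0 = 1"
    and m: "\<And>z. Im z \<noteq> 0 \<Longrightarrow> \<exists>K. \<forall>x\<ge>0. integral {0..x}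
      (edens (\<lambda>x. \<phi>1 z x + m z * \<theta>1 z x) (\<lambda>x. \<phi>2 z x + m z * \<theta>2 z x)) \<le> K"
    and S: "compact S" "S \<inter> \<real> = {}"
  shows "uniform_limit S (\<lambda>r \<mu>. - (\<mu> * of_real (r * X r) * m (of_real r * \<mu>)) - 1) (\<lambda>_. 0) at_top"
proof (cases "S = {}")
  case True
  then show ?thesis by simp
next
  case False
  have "bounded S" using S by (rule_tac compact_imp_bounded)
  then obtain B0 where B0: "\<And>\<mu>. \<mu> \<in> S \<Longrightarrow> cmod \<mu> \<le> B0" by (auto simp: bounded_iff)
  define B where "B = max 1 B0"
  have B: "1 \<le> B" "\<And>\<mu>. \<mu> \<in> S \<Longrightarrow> cmod \<mu> \<le> B" using B0 by (auto simp: B_def le_max_iff_disj)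
  have "continuous_on S (\<lambda>\<mu>. \<bar>Im \<mu>\<bar>)" by (intro continuous_intros)
  then obtain \<mu>0 where \<mu>0: "\<mu>0 \<in> S" "\<And>\<mu>. \<mu> \<in> S \<Longrightarrow> \<bar>Im \<mu>0\<bar> \<le> \<bar>Im \<mu>\<bar>"
    using continuous_attains_inf[OF S(1) False] by blast
  define \<beta> where "\<beta> = \<bar>Im \<mu>0\<bar>"
  have \<beta>: "0 < \<beta>" "\<And>\<mu>. \<mu> \<in> S \<Longrightarrow> \<beta> \<le> \<bar>Im \<mu>\<bar>"
    using \<mu>0 S(2) complex_is_Real_iff by (auto simp: \<beta>_def)
  define D where "D = 1 + 1 / \<beta>"
  show ?thesis
    unfolding uniform_limit_iff
  proof (intro allI impI)
    fix \<epsilon> :: real assume \<epsilon>: "0 < \<epsilon>"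
    \<comment> \<open>The bound \<open>1\<close> serves the absorption of half of \<open>T\<close>;
      \<open>\<epsilon> / 2\<close> makes the final inequality strict.\<close>
    define \<epsilon>' where "\<epsilon>' = min 1 (\<epsilon> / 2)"
    have \<epsilon>': "0 < \<epsilon>'" "\<epsilon>' \<le> 1" "\<epsilon>' < \<epsilon>" using \<epsilon> by (auto simp: \<epsilon>'_def)
    \<comment> \<open>The terms of \<open>\<tau>\<close> that depend on \<open>\<eta>\<close> alone
      are pushed below half of \<open>\<epsilon>'\<close> first. The rest, in \<open>\<rho>\<close>
      and \<open>\<sigma>\<close>, tends to \<open>0\<close> as \<open>r\<close> grows with
      \<open>\<eta>\<close> fixed.\<close>
    have "((\<lambda>\<eta>. 2 * D * (\<eta> * B + 2 * B * D * sqrt \<eta> + 6 * D * B * sqrt \<eta>)) \<longlongrightarrow>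
        2 * D * (0 * B + 2 * B * D * sqrt 0 + 6 * D * B * sqrt 0)) (at_right 0)"
      by (intro tendsto_intros)
    then have "\<forall>\<^sub>F \<eta> in at_right 0. 2 * D * (\<eta> * B + 2 * B * D * sqrt \<eta> + 6 * D * B * sqrt \<eta>) < \<epsilon>' / 2"
      using \<epsilon>' by (intro order_tendstoD(2)[where y = 0]) auto
    moreover have "\<forall>\<^sub>F \<eta> in at_right 0. (0 :: real) < \<eta> \<and> \<eta> < 1"
      using eventually_at_right_less[of 0] eventually_at_right_real[of 0 1] by auto
    ultimately have "\<forall>\<^sub>F \<eta> in at_right 0. 2 * D * (\<eta> * B + 2 * B * D * sqrt \<eta> + 6 * D * B * sqrt \<eta>) < \<epsilon>' / 2
        \<and> (0 :: real) < \<eta> \<and> \<eta> < 1"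
      by eventually_elim auto
    then obtain \<eta> :: real where \<eta>: "0 < \<eta>" "\<eta> < 1"
      "2 * D * (\<eta> * B + 2 * B * D * sqrt \<eta> + 6 * D * B * sqrt \<eta>) < \<epsilon>' / 2"
      using eventually_happens[of _ "at_right (0::real)"] by (auto simp: trivial_limit_at_right_real)
    define \<rho> where "\<rho> r = mass ((1 - \<eta>) * X r) / mass (X r)" for r
    define \<kappa> where "\<kappa> r = mass ((1 + \<eta>) * X r) / mass (X r)" for r
    define \<sigma> where "\<sigma> r = mass (X r) / X r" for r
    have \<rho>: "(\<rho> \<longlongrightarrow> 0) at_top" and \<sigma>: "(\<sigma> \<longlongrightarrow> 0) at_top" and \<kappa>: "filterlim \<kappa> at_top at_top"
      using mass_ratio_below[of \<eta>] mass_over_scale mass_ratio_above[of \<eta>] \<eta>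
      by (auto simp: \<rho>_def[abs_def] \<kappa>_def[abs_def] \<sigma>_def[abs_def])
    have "((\<lambda>r. 2 * D * (3 * B\<^sup>2 * D * sqrt (\<rho> r) + B * \<sigma> r)) \<longlongrightarrow> 2 * D * (3 * B\<^sup>2 * D * sqrt 0 + B * 0)) at_top"
      by (intro tendsto_intros \<rho> \<sigma>)
    then have "\<forall>\<^sub>F r in at_top. 2 * D * (3 * B\<^sup>2 * D * sqrt (\<rho> r) + B * \<sigma> r) < \<epsilon>' / 2"
      using \<epsilon>' by (intro order_tendstoD(2)[where y = 0]) auto
    moreover have "\<forall>\<^sub>F r in at_top. \<rho> r < 1 / 2"
      by (rule order_tendstoD(2)[OF \<rho>]) simp
    moreover have "\<forall>\<^sub>F r in at_top. max 1 (4 / \<eta>) \<le> \<kappa> r"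
      using \<kappa> unfolding filterlim_at_top by blast
    ultimately show "\<forall>\<^sub>F r in at_top. \<forall>\<mu>\<in>S. dist (- (\<mu> * of_real (r * X r) * m (of_real r * \<mu>)) - 1) 0 < \<epsilon>"
      using eventually_gt_at_top[of 0]
    proof eventually_elim
      case (elim r)
      show ?case
      proof
        fix \<mu> assume \<mu>: "\<mu> \<in> S"
        \<comment> \<open>\<open>w\<close> and \<open>s\<close> are the roots of the units of length
          and mass. The choice of \<open>X\<close> gives \<open>r = 1 / (w * s)\<close>, hence
          \<open>M = (w / s) * m z\<close>.\<close>
        define w where "w = sqrt (X r)"
        define s where "s = sqrt (mass (X r))"
        define z where "z = of_real r * \<mu>"
        define M where "M = of_real (r * X r) * m z"
        define e where "e = sqrt (cmod M / \<beta>)"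
        have Xr: "0 < X r" "0 < mass (X r)" using X(1)[of r] mass_pos elim by auto
        have ws: "0 < w" "0 < s" "w\<^sup>2 = X r" "s\<^sup>2 = mass (X r)" using Xr by (auto simp: w_def s_def)
        have "r\<^sup>2 = (1 / (w * s))\<^sup>2"
          using X(2)[of r] elim by (simp add: power_divide power_mult_distrib ws)
        then have r: "r = 1 / (w * s)"
          by (rule power2_eq_imp_eq) (use elim(4) ws in auto)
        have Imz: "Im z = r * Im \<mu>" by (simp add: z_def)
        have nz: "Im z \<noteq> 0" using \<beta>(1) \<beta>(2)[OF \<mu>] elim by (auto simp: Imz)
        obtain K where K: "\<And>x. 0 \<le> x \<Longrightarrow> integral {0..x}
            (edens (\<lambda>x. \<phi>1 z x + m z * \<theta>1 z x) (\<lambda>x. \<phi>2 z x + m z * \<theta>2 z x)) \<le> K"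
          using m[OF nz] by blast
        have mM: "m z = M * of_real (s / w)"
        proof -
          have "r * w\<^sup>2 = w / s"
            using ws(1,2) by (simp add: r power2_eq_square)
          then have "r * X r = w / s" by (simp only: ws(3))
          then have "M = of_real (w / s) * m z" by (simp only: M_def)
          then show ?thesis using ws(1,2) by simp
        qed
        \<comment> \<open>The Weyl bound in rescaled units: \<open>|Im z| \<ge> r * \<beta>\<close>
          and \<open>|m z| = |M| * s / w\<close> give \<open>|M| * s\<^sup>2 / \<beta>\<close>,
          which fixes the choice of \<open>e\<close>.\<close>
        have "Im (m z) / Im z \<le> cmod (m z) / (r * \<beta>)"
        proof -
          have "Im (m z) / Im z \<le> \<bar>Im (m z)\<bar> / \<bar>Im z\<bar>" by (metis abs_divide abs_ge_self)
          also have "\<dots> \<le> cmod (m z) / (r * \<beta>)"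
            using abs_Im_le_cmod[of "m z"] \<beta>(1) \<beta>(2)[OF \<mu>] elim
            by (intro frac_le) (auto simp: Imz abs_mult)
          finally show ?thesis .
        qed
        also have "\<dots> = (e * s)\<^sup>2"
          using ws \<beta>(1) unfolding mM r e_def by (simp add: norm_mult power_mult_distrib norm_divide) (simp add: field_simps power2_eq_square)
        finally have energy: "integral {0..x}
            (edens (\<lambda>x. \<phi>1 z x + m z * \<theta>1 z x) (\<lambda>x. \<phi>2 z x + m z * \<theta>2 z x)) \<le> (e * s)\<^sup>2" if "0 \<le> x" for x
          using weyl_energy_bound[OF \<phi> \<theta> nz K that] by linarith
        have sol: "sol z (\<lambda>x. \<phi>1 z x + m z * \<theta>1 z x) (\<lambda>x. \<phi>2 z x + m z * \<theta>2 z x)"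
          using sol_lin_comb[OF \<phi>(1) \<theta>(1), of z 1 "m z"] by simp
        have zz: "z = \<mu> / of_real (w * s)" by (simp add: z_def r)
        note est = rescaled_estimate[OF sol _ _ energy ws(1,2) _ \<eta>(1,2) zz, of M "\<rho> r" "\<kappa> r"]
        have "cmod (1 + \<mu> * M) \<le> \<epsilon>'"
        proof (rule rescaled_conclusion[OF norm_ge_zero B(2)[OF \<mu>] B(1) \<beta>(1) _ norm_ge_zero norm_ge_zero
              e_def \<eta>(1,2) _ _ _ _ _ refl])
          have "\<beta> * cmod M \<le> cmod \<mu> * cmod M"
            using \<beta>(2)[OF \<mu>] abs_Im_le_cmod[of \<mu>] by (intro mult_right_mono) auto
          also have "\<dots> = cmod ((1 + \<mu> * M) - 1)" by (simp add: norm_mult)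
          also have "\<dots> \<le> 1 + cmod (1 + \<mu> * M)" using norm_triangle_ineq4[of "1 + \<mu> * M" 1] by simp
          finally show "\<beta> * cmod M \<le> 1 + cmod (1 + \<mu> * M)" .
          show "0 \<le> \<rho> r" "0 \<le> s\<^sup>2 / w\<^sup>2" "\<rho> r \<le> 1 / 2" "1 \<le> \<kappa> r"
            using Xr elim integral_a_nonneg by (auto simp: \<rho>_def)
          have "0 < \<kappa> r" "4 / \<eta> \<le> \<kappa> r" using elim(3) by auto
          then show "4 / \<kappa> r \<le> \<eta>"
            using \<eta>(1) by (simp add: pos_divide_le_eq mult.commute)
          have "s\<^sup>2 / w\<^sup>2 = \<sigma> r" by (simp add: ws \<sigma>_def)
          then show "2 * (1 + 1 / \<beta>) * (3 * B\<^sup>2 * (1 + 1 / \<beta>) * sqrt (\<rho> r) + B * (s\<^sup>2 / w\<^sup>2) + \<eta> * B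
              + 2 * B * (1 + 1 / \<beta>) * sqrt \<eta> + 6 * (1 + 1 / \<beta>) * B * sqrt \<eta>) \<le> \<epsilon>'"
            and "2 * (1 + 1 / \<beta>) * (3 * B\<^sup>2 * (1 + 1 / \<beta>) * sqrt (\<rho> r) + B * (s\<^sup>2 / w\<^sup>2) + \<eta> * B
              + 2 * B * (1 + 1 / \<beta>) * sqrt \<eta> + 6 * (1 + 1 / \<beta>) * B * sqrt \<eta>) \<le> 1"
            using elim(1) \<eta>(3) \<epsilon>'(2) unfolding D_def[symmetric] by (simp_all add: distrib_left)
          show "(cmod (1 + \<mu> * M) - (cmod \<mu> * sqrt (\<rho> r) * (1 + 2 * cmod \<mu> * e) + cmod \<mu> * cmod M * (s\<^sup>2 / w\<^sup>2)
              + \<eta> * cmod \<mu> * cmod M + cmod \<mu> * sqrt (2 * \<eta>) * e))\<^sup>2 * (\<kappa> r - \<rho> r)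
            \<le> 2 * e\<^sup>2 + 4 * \<eta> * (cmod M + cmod \<mu> * sqrt (\<kappa> r) * e)\<^sup>2"
            if "cmod \<mu> * sqrt (\<rho> r) * (1 + 2 * cmod \<mu> * e) + cmod \<mu> * cmod M * (s\<^sup>2 / w\<^sup>2)
              + \<eta> * cmod \<mu> * cmod M + cmod \<mu> * sqrt (2 * \<eta>) * e \<le> cmod (1 + \<mu> * M)"
          proof (rule est)
            show "\<phi>1 z 0 + m z * \<theta>1 z 0 = 1" "\<phi>2 z 0 + m z * \<theta>2 z 0 = M * of_real (s / w)"
              using \<phi> \<theta> mM by auto
            show "0 \<le> e" using \<beta>(1) by (simp add: e_def)
            show "mass (w\<^sup>2) = s\<^sup>2" "mass ((1 - \<eta>) * w\<^sup>2) = \<rho> r * s\<^sup>2" "mass ((1 + \<eta>) * w\<^sup>2) = \<kappa> r * s\<^sup>2"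
              using Xr by (auto simp: ws \<rho>_def \<kappa>_def)
          qed (use that in auto)
        qed
        moreover have "dist (- (\<mu> * of_real (r * X r) * m (of_real r * \<mu>)) - 1) 0 = cmod (1 + \<mu> * M)"
        proof -
          have "- (\<mu> * of_real (r * X r) * m (of_real r * \<mu>)) - 1 = - (1 + \<mu> * M)"
            by (simp add: M_def z_def algebra_simps)
          then show ?thesis by (simp only: dist_norm diff_zero norm_minus_cancel)
        qed
        ultimately show "dist (- (\<mu> * of_real (r * X r) * m (of_real r * \<mu>)) - 1) 0 < \<epsilon>"
          using \<epsilon>' by linarith
      qed
    qed
  qed
qed

end

end

end

section \<open>Hamiltonians and their coefficients\<close>

lemma psd_entries:
  fixes M :: "real^2^2"
  assumes sym: "transpose M = M" and psd: "\<And>v. 0 \<le> v \<bullet> (M *v v)" and tr: "trace M = 1"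
  shows "0 \<le> M $ 1 $ 1" "0 \<le> M $ 2 $ 2" "(M $ 1 $ 2)\<^sup>2 \<le> M $ 1 $ 1 * M $ 2 $ 2"
    "M $ 1 $ 1 + M $ 2 $ 2 = 1" "M $ 2 $ 1 = M $ 1 $ 2"
proof -
  let ?a = "M $ 1 $ 1" and ?b = "M $ 1 $ 2" and ?c = "M $ 2 $ 2"
  show s: "M $ 2 $ 1 = ?b" using arg_cong[OF sym, of "\<lambda>M. M $ 1 $ 2"] by (simp add: transpose_def)
  have q: "0 \<le> ?a * x\<^sup>2 + 2 * ?b * x * y + ?c * y\<^sup>2" for x y
    using psd[of "vector [x, y]"]
    by (simp add: inner_vec_def matrix_vector_mult_def sum_2 s power2_eq_square algebra_simps)
  show "0 \<le> ?a" "0 \<le> ?c" using q[of 1 0] q[of 0 1] by auto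
  show t: "?a + ?c = 1" using tr by (simp add: trace_def sum_2)
  \<comment> \<open>The form at \<open>(c, -b)\<close> and at \<open>(-b, a)\<close> is
    \<open>c\<close> and \<open>a\<close> times the determinant. Adding the two avoids a case
    distinction on vanishing entries, since the trace is \<open>1\<close>.\<close>
  have "0 \<le> (?a + ?c) * (?a * ?c - ?b\<^sup>2)"
    using q[of ?c "- ?b"] q[of "- ?b" ?a] by (simp add: power2_eq_square algebra_simps)
  then show "?b\<^sup>2 \<le> ?a * ?c" by (simp add: t)
qed

context
  fixes H :: "real \<Rightarrow> real^2^2"
begin

definition regular_point :: "real \<Rightarrow> bool" where
  "regular_point x \<longleftrightarrow> 0 \<le> x \<and> transpose (H x) = H x \<and> (\<forall>v. 0 \<le> v \<bullet> (H x *v v)) \<and> trace (H x) = 1"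

text \<open>The default at irregular points, including all negative arguments, is
  \<open>diag(1, 0)\<close>: nonnegative and of trace \<open>1\<close>, so that the conditions of
  \<open>canonical_system\<close> hold everywhere.\<close>

definition coeff :: "2 \<Rightarrow> 2 \<Rightarrow> real \<Rightarrow> real" where
  "coeff i j x = (if regular_point x then H x $ i $ j else if i = 1 \<and> j = 1 then 1 else 0)"

lemma canonical_system_coeff:
  assumes "hamiltonian H" "trace_normed H"
  obtains N where "negligible N" "\<And>x i j. x \<in> {0..} - N \<Longrightarrow> coeff i j x = H x $ i $ j"
    "\<And>x. x \<in> {0..} - N \<Longrightarrow> H x $ 2 $ 1 = H x $ 1 $ 2"
    "canonical_system (coeff 1 1) (coeff 1 2) (coeff 2 2)"
proof -
  have "AE x in lebesgue. x \<in> {0..} \<longrightarrow> regular_point x"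
  proof -
    have "AE x in lebesgue. x \<in> {0..} \<longrightarrow> (\<forall>v. 0 \<le> v \<bullet> (H x *v v)) \<and> H x \<noteq> 0"
      "AE x in lebesgue. x \<in> {0..} \<longrightarrow> trace (H x) = 1"
      using assms by (auto simp: hamiltonian_def trace_normed_def)
    then show ?thesis
      by eventually_elim (use assms in \<open>auto simp: regular_point_def hamiltonian_def\<close>)
  qed
  then obtain N where N: "N \<in> null_sets lebesgue" "{x. \<not> (x \<in> {0..} \<longrightarrow> regular_point x)} \<subseteq> N"
    unfolding eventually_ae_filter by auto
  have neg: "negligible N" using N(1) by (simp add: negligible_iff_null_sets)
  have reg: "regular_point x" if "x \<in> {0..} - N" for x using N(2) that by auto
  have eq: "coeff i j x = H x $ i $ j" if "x \<in> {0..} - N" for x i j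
    using reg[OF that] by (simp add: coeff_def)
  have sym: "H x $ 2 $ 1 = H x $ 1 $ 2" if "x \<in> {0..} - N" for x
    using reg[OF that] psd_entries(5)[of "H x"] by (simp add: regular_point_def)
  have int: "coeff i j absolutely_integrable_on {0..R}" for i j R
  proof (cases "0 \<le> R")
    case True
    then have "(\<lambda>x. H x $ i $ j) absolutely_integrable_on {0..R}"
      using assms(1) by (simp add: hamiltonian_def)
    then show ?thesis
      by (rule absolutely_integrable_spike[OF _ neg]) (use eq in auto)
  qed (auto simp: absolutely_integrable_on_def)
  have "canonical_system (coeff 1 1) (coeff 1 2) (coeff 2 2)"
  proof
    fix t
    show "0 \<le> coeff 1 1 t" "0 \<le> coeff 2 2 t" "(coeff 1 2 t)\<^sup>2 \<le> coeff 1 1 t * coeff 2 2 t"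
      "coeff 1 1 t + coeff 2 2 t = 1"
      using psd_entries[of "H t"] by (auto simp: coeff_def regular_point_def)
  qed (rule int)+
  then show ?thesis using that neg eq sym by blast
qed

end

lemma matrix_product_entry_2:
  fixes A B :: "'a::semiring_1^2^2"
  shows "(A ** B) $ i $ k = A $ i $ 1 * B $ 1 $ k + A $ i $ 2 * B $ 2 $ k"
  by (simp add: matrix_matrix_mult_def sum_2)

text \<open>The integrated equation does not see the null set on which \<open>H\<close> was changed.
  Multiplication by \<open>J\<close> swaps the rows of \<open>U\<close> with one sign, so the second
  row of the matrix equation becomes the equation for \<open>f1\<close>.\<close>

lemma fundamental_solution_column:
  assumes fs: "fundamental_solution H U" and N: "negligible N"
    and eq: "\<And>x i j. x \<in> {0..} - N \<Longrightarrow> coeff H i j x = H x $ i $ j"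
    and sym: "\<And>x. x \<in> {0..} - N \<Longrightarrow> H x $ 2 $ 1 = H x $ 1 $ 2"
    and cs: "canonical_system (coeff H 1 1) (coeff H 1 2) (coeff H 2 2)"
  shows "canonical_system.sol (coeff H 1 1) (coeff H 1 2) (coeff H 2 2) z
    (\<lambda>x. U z x $ 1 $ k) (\<lambda>x. U z x $ 2 $ k)"
proof -
  interpret canonical_system "coeff H 1 1" "coeff H 1 2" "coeff H 2 2" by (rule cs)
  have entry: "bounded_linear (\<lambda>M :: complex^2^2. M $ i $ j)" for i j
    by (rule bounded_linear_compose[OF bounded_linear_vec_nth bounded_linear_vec_nth])
  have cont: "continuous_on {0..} (\<lambda>x. U z x $ i $ k)" for i
    using fs by (intro bounded_linear.continuous_on[OF entry]) (simp add: fundamental_solution_def)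
  have int: "((\<lambda>t. z * (H t $ i $ 1 * U z t $ 1 $ k + H t $ i $ 2 * U z t $ 2 $ k))
      has_integral (J ** (U z x - U z 0)) $ i $ k) {0..x}" if "0 \<le> x" for x i
  proof -
    have "((\<lambda>t. map_matrix (\<lambda>h. z * complex_of_real h) (H t) ** U z t) has_integral J ** (U z x - U z 0)) {0..x}"
      using fs that unfolding fundamental_solution_def by blast
    from has_integral_linear[OF this entry[of i k]] show ?thesis
      by (simp add: o_def matrix_product_entry_2 map_matrix_def algebra_simps)
  qed
  have J: "(J ** D) $ 1 $ k = - (D $ 2 $ k)" "(J ** D) $ 2 $ k = D $ 1 $ k" for D
    by (simp_all add: matrix_product_entry_2 J_def)
  show ?thesis
    unfolding sol_def
  proof (intro conjI allI impI cont)
    fix x :: real assume x: "0 \<le> x"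
    have "((\<lambda>t. z * (H t $ 2 $ 1 * U z t $ 1 $ k + H t $ 2 $ 2 * U z t $ 2 $ k))
        has_integral (U z x $ 1 $ k - U z 0 $ 1 $ k)) {0..x}"
      using int[OF x, of 2] by (simp add: J)
    then show "((\<lambda>t. z * (coeff H 1 2 t * U z t $ 1 $ k + coeff H 2 2 t * U z t $ 2 $ k))
        has_integral (U z x $ 1 $ k - U z 0 $ 1 $ k)) {0..x}"
      by (rule has_integral_spike[OF N, rotated]) (use eq sym in auto)
    have "((\<lambda>t. - (z * (H t $ 1 $ 1 * U z t $ 1 $ k + H t $ 1 $ 2 * U z t $ 2 $ k)))
        has_integral (U z x $ 2 $ k - U z 0 $ 2 $ k)) {0..x}"
      using has_integral_neg[OF int[OF x, of 1]] by (simp add: J)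
    then show "((\<lambda>t. - z * (coeff H 1 1 t * U z t $ 1 $ k + coeff H 1 2 t * U z t $ 2 $ k))
        has_integral (U z x $ 2 $ k - U z 0 $ 2 $ k)) {0..x}"
      by (rule has_integral_spike[OF N, rotated]) (use eq sym in auto)
  qed
qed

text \<open>Off the null set the complex integrand is the nonnegative energy density, so it equals
  its own modulus, whose integral over the half-line bounds every partial integral.\<close>

lemma in_L2_bounded_energy:
  assumes L2: "in_L2 H f" and N: "negligible N"
    and eq: "\<And>x i j. x \<in> {0..} - N \<Longrightarrow> coeff H i j x = H x $ i $ j"
    and sym: "\<And>x. x \<in> {0..} - N \<Longrightarrow> H x $ 2 $ 1 = H x $ 1 $ 2"
    and cs: "canonical_system (coeff H 1 1) (coeff H 1 2) (coeff H 2 2)"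
    and cont: "continuous_on {0..} (\<lambda>x. f x $ 1)" "continuous_on {0..} (\<lambda>x. f x $ 2)"
  obtains K where "\<And>x. 0 \<le> x \<Longrightarrow> integral {0..x}
    (canonical_system.edens (coeff H 1 1) (coeff H 1 2) (coeff H 2 2) (\<lambda>x. f x $ 1) (\<lambda>x. f x $ 2)) \<le> K"
proof -
  interpret canonical_system "coeff H 1 1" "coeff H 1 2" "coeff H 2 2" by (rule cs)
  define g where "g x = (\<Sum>i\<in>UNIV. \<Sum>j\<in>UNIV. cnj (f x $ i) * complex_of_real (H x $ i $ j) * f x $ j)" for x
  have g: "(\<lambda>x. cmod (g x)) integrable_on {0..}"
    using L2 unfolding in_L2_def g_def[abs_def] absolutely_integrable_on_def by blast
  have ge: "cmod (g x) = edens (\<lambda>x. f x $ 1) (\<lambda>x. f x $ 2) x" if x: "x \<in> {0..} - N" for x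
  proof -
    have "g x = of_real (edens (\<lambda>x. f x $ 1) (\<lambda>x. f x $ 2) x)"
      unfolding g_def edens_def qform_def eq[OF x] sum_2 sym[OF x] cmod_power2
      by (simp add: complex_eq_iff power2_eq_square algebra_simps)
    then show ?thesis using edens_nonneg by (simp add: norm_of_real)
  qed
  show ?thesis
  proof (rule that)
    fix x :: real assume x: "0 \<le> x"
    have sub: "(\<lambda>x. cmod (g x)) integrable_on {0..x}"
      by (rule integrable_spike[OF edens_integrable[OF cont, of 0 x] N]) (use ge in auto)
    have "integral {0..x} (edens (\<lambda>x. f x $ 1) (\<lambda>x. f x $ 2)) = integral {0..x} (\<lambda>x. cmod (g x))"
      by (rule integral_spike[OF N]) (use ge in auto)
    also have "\<dots> \<le> integral {0..} (\<lambda>x. cmod (g x))"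
      by (intro integral_subset_le sub g) auto
    finally show "integral {0..x} (edens (\<lambda>x. f x $ 1) (\<lambda>x. f x $ 2)) \<le> integral {0..} (\<lambda>x. cmod (g x))" .
  qed
qed

text \<open>Substitute \<open>x = 1 / y\<close> in the defining limit; the two reciprocals exchange
  numerator and denominator.\<close>

lemma rapidly_varying_at_0_ratio:
  assumes "rapidly_varying_at_0 A" "1 < t"
  shows "filterlim (\<lambda>y. A y / A (y / t)) at_top (at_right 0)"
proof -
  have "filterlim (\<lambda>x. (1 / A (1 / (x * t))) / (1 / A (1 / x))) at_top at_top"
    using assms by (simp add: rapidly_varying_at_0_def rapidly_varying_at_infinity_def)
  from filterlim_compose[OF this filterlim_inverse_at_top_right] show ?thesis
    by (simp add: divide_simps)
qed

theorem theorem3p11: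
  fixes H :: "real \<Rightarrow> real^2^2"
    and U :: "complex \<Rightarrow> real \<Rightarrow> complex^2^2"
    and m :: "complex \<Rightarrow> complex"
    and A F f :: "real \<Rightarrow> real"
    and K :: "complex set"
  assumes "hamiltonian H" and "trace_normed H"
    and "fundamental_solution H U" and "m_function H U m"
    and "A = (\<lambda>x. integral {0..x} (\<lambda>t. H t $ 1 $ 1))"
    and "rapidly_varying_at_0 A"
    and "F = the_inv_into {0<..} (\<lambda>x. 1 / (x * A x))"
    and "f = (\<lambda>r. r * F (r\<^sup>2))"
    and "compact K" and "K \<inter> \<real> = {}"
  shows "\<exists>e :: real \<Rightarrow> complex \<Rightarrow> complex.
           uniform_limit K e (\<lambda>_. 0) at_top \<and>
           (\<forall>\<^sub>F r in at_top. \<forall>\<mu>\<in>K.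
              m (of_real r * \<mu>) = - (1 / (\<mu> * of_real (f r))) * (1 + e r \<mu>))"
proof -
  obtain N where N: "negligible N" "\<And>x i j. x \<in> {0..} - N \<Longrightarrow> coeff H i j x = H x $ i $ j"
    "\<And>x. x \<in> {0..} - N \<Longrightarrow> H x $ 2 $ 1 = H x $ 1 $ 2"
    and cs: "canonical_system (coeff H 1 1) (coeff H 1 2) (coeff H 2 2)"
    using canonical_system_coeff[OF assms(1,2)] by blast
  interpret canonical_system "coeff H 1 1" "coeff H 1 2" "coeff H 2 2" by (rule cs)
  have A: "A = mass"
    unfolding assms(5) by (intro ext integral_spike[OF N(1)]) (use N(2) in auto)
  \<comment> \<open>Rapid variation gives positivity only near \<open>0\<close>; monotonicity
    carries it to all \<open>x > 0\<close>, as needed for inverting \<open>1 / (x * mass x)\<close>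
    on the whole half-line.\<close>
  have mass_pos: "0 < mass x" if x: "0 < x" for x
  proof -
    have "\<forall>\<^sub>F y in at_right 0. 0 < mass y"
      using assms(6) by (simp add: rapidly_varying_at_0_def A)
    moreover have "\<forall>\<^sub>F y in at_right 0. 0 < y \<and> y < x"
      using eventually_at_right_real[OF x] by eventually_elim auto
    ultimately have "\<forall>\<^sub>F y in at_right 0. 0 < mass y \<and> 0 < y \<and> y < x"
      by eventually_elim auto
    then obtain y where "0 < mass y" "0 < y" "y < x"
      using eventually_happens[of _ "at_right (0::real)"] by (auto simp: trivial_limit_at_right_real)
    then show ?thesis using mass_mono[of y x] by linarith
  qed
  define X where "X r = F (r\<^sup>2)" for r
  have surj: "r\<^sup>2 \<in> (\<lambda>x. 1 / (x * mass x)) ` {0<..}" if "0 < r" for r :: real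
    using inverse_mult_mass_surj[OF mass_pos, of "r\<^sup>2"] that by simp
  have X: "0 < X r" "1 / (X r * mass (X r)) = r\<^sup>2" if "0 < r" for r
    using the_inv_into_into[OF inj_on_inverse_mult_mass[OF mass_pos] surj[OF that] order_refl]
      f_the_inv_into_f[OF inj_on_inverse_mult_mass[OF mass_pos] surj[OF that]]
    by (auto simp: X_def assms(7) A)
  have rapid: "filterlim (\<lambda>y. mass y / mass (y / t)) at_top (at_right 0)" if "1 < t" for t
    using rapidly_varying_at_0_ratio[OF assms(6) that] by (simp add: A)
  have sol: "sol z (\<lambda>x. U z x $ 1 $ k) (\<lambda>x. U z x $ 2 $ k)" for z k
    by (rule fundamental_solution_column[OF assms(3) N cs])
  have U0: "U z 0 = mat 1" for z using assms(3) by (simp add: fundamental_solution_def)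
  have energy: "\<exists>C. \<forall>x\<ge>0. integral {0..x} (edens (\<lambda>x. U z x $ 1 $ 1 + m z * U z x $ 1 $ 2)
      (\<lambda>x. U z x $ 2 $ 1 + m z * U z x $ 2 $ 2)) \<le> C" if "Im z \<noteq> 0" for z
  proof -
    have comp: "(U z x *v vector [1, m z]) $ i = U z x $ i $ 1 + m z * U z x $ i $ 2" for x i
      by (simp add: matrix_vector_mult_def sum_2)
    have L2: "in_L2 H (\<lambda>x. U z x *v vector [1, m z])"
      using assms(4) that complex_is_Real_iff by (auto simp: m_function_def)
    have "continuous_on {0..} (\<lambda>x. (U z x *v vector [1, m z]) $ 1)"
      "continuous_on {0..} (\<lambda>x. (U z x *v vector [1, m z]) $ 2)"
      unfolding comp by (auto intro!: continuous_on_add continuous_on_mult_left sol_continuous[OF sol])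
    then obtain C where "\<And>x. 0 \<le> x \<Longrightarrow> integral {0..x}
        (edens (\<lambda>x. (U z x *v vector [1, m z]) $ 1) (\<lambda>x. (U z x *v vector [1, m z]) $ 2)) \<le> C"
      using in_L2_bounded_energy[OF L2 N cs] by blast
    then show ?thesis unfolding comp by blast
  qed
  \<comment> \<open>The error is obtained by solving the claimed formula for it, so the formula is
    exact for every \<open>r > 0\<close>, where \<open>f r\<close> and \<open>\<mu>\<close> are
    nonzero. Only the uniform limit has content.\<close>
  define e where "e r \<mu> = - (\<mu> * of_real (r * X r) * m (of_real r * \<mu>)) - 1" for r \<mu>
  have "uniform_limit K e (\<lambda>_. 0) at_top"
    unfolding e_def[abs_def]
    by (rule m_function_asymptotics[OF mass_pos X rapid sol _ _ sol _ _ energy assms(9,10)])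
       (auto simp: U0 mat_def)
  moreover have "\<forall>\<^sub>F r in at_top. \<forall>\<mu>\<in>K.
      m (of_real r * \<mu>) = - (1 / (\<mu> * of_real (f r))) * (1 + e r \<mu>)"
    using eventually_gt_at_top[of 0]
  proof eventually_elim
    case (elim r)
    have "\<mu> \<noteq> 0" if "\<mu> \<in> K" for \<mu> using that assms(10) by auto
    then show ?case
      using X(1)[OF elim] elim by (simp add: e_def assms(8) X_def[symmetric])
  qed
  ultimately show ?thesis by blast
qed

end
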